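(* Let $d\ge2$ be an integer. If $d$ is prime, let $m=2$; if $d$ is composite, let $m$ be the smallest positive integer such that $2d-2+m$ is prime. Let $a=\mathbf{0}$ and $b=\mathbf{1}$ (the all-ones vector) in $\mathbb{Z}_2^d$. Then the quantum walk with respect to $(Q_d,W_m)$ admits $ab$-PGST.
   Context: The hypercube $Q_d$ has vertex set $\mathbb{Z}_2^d$, with $u\sim v$ iff $u-v\in\{e_0,\dots,e_{d-1}\}$ (standard basis vectors). $W_m$ is the weighted adjacency matrix of $Q_d$ with $(W_m)_{u,v}=\sqrt{m}$ if $u-v=e_0$, $\sqrt2$ if $u-v=e_j$ with $1\le j\le d-1$, and $0$ otherwise. For a connected graph $X$ and a complex-weighted adjacency matrix $W$ ($W_{uv}\ne0$ iff $u\sim v$): arcs are ordered pairs $(u,v)$ with $\{u,v\}\in E(X)$; $R$ is the permutation matrix on arcs swapping $(u,v)$ and $(v,u)$; $N_t$ is the vertex-by-arc matrix with $(N_t)_{u,(a,b)}=w_{ab}/\sqrt{(WW^* )_{aa}}$ if $u=a$, else $0$; the quantum walk with respect to $(X,W)$ has transition matrix $U=R(2N_t^*N_t-I)$. Pretty good state transfer from state $x$ to state $y$ means there is unimodular $\gamma\in\mathbb{C}$ such that for every $\epsilon>0$ some $t\in\mathbb{Z}$ has $\|U^tx-\gamma y\|<\epsilon$; $ab$-PGST means PGST from $N_t^*e_a$ to $N_t^*e_b$. *)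

theory Defs
  imports "HOL-Analysis.Analysis" "HOL-Library.Z2" "HOL-Computational_Algebra.Primes"
begin

text \<open>
  Matrices and vectors whose rows and columns are indexed by finite sets are represented by functions.
  The index set is an explicit argument of every operation that sums over it; entries outside of
  the index sets are irrelevant.
\<close>

type_synonym ('i, 'j) cmatrix = "'i \<Rightarrow> 'j \<Rightarrow> complex"
type_synonym 'i cvector = "'i \<Rightarrow> complex"

definition std_basis :: "'i \<Rightarrow> 'i \<Rightarrow> 'c::zero_neq_one" where
  "std_basis j = (\<lambda>i. if i = j then 1 else 0)"

definition id_mat :: "('i, 'i) cmatrix" where
  "id_mat = (\<lambda>i j. if i = j then 1 else 0)"

definition mat_mult :: "'j set \<Rightarrow> ('i, 'j) cmatrix \<Rightarrow> ('j, 'k) cmatrix \<Rightarrow> ('i, 'k) cmatrix" where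
  "mat_mult J A B = (\<lambda>i k. \<Sum>j\<in>J. A i j * B j k)"

definition mat_vec :: "'j set \<Rightarrow> ('i, 'j) cmatrix \<Rightarrow> 'j cvector \<Rightarrow> 'i cvector" where
  "mat_vec J A x = (\<lambda>i. \<Sum>j\<in>J. A i j * x j)"

definition conj_transpose :: "('i, 'j) cmatrix \<Rightarrow> ('j, 'i) cmatrix" where
  "conj_transpose A = (\<lambda>j i. cnj (A i j))"

definition inverse_mats :: "'i set \<Rightarrow> ('i, 'i) cmatrix \<Rightarrow> ('i, 'i) cmatrix \<Rightarrow> bool" where
  "inverse_mats I A B \<longleftrightarrow>
     (\<forall>i\<in>I. \<forall>j\<in>I. mat_mult I A B i j = id_mat i j \<and> mat_mult I B A i j = id_mat i j)"

definition mat_inverse :: "'i set \<Rightarrow> ('i, 'i) cmatrix \<Rightarrow> ('i, 'i) cmatrix" where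
  "mat_inverse I A = (SOME B. inverse_mats I A B)"

primrec mat_power :: "'i set \<Rightarrow> ('i, 'i) cmatrix \<Rightarrow> nat \<Rightarrow> ('i, 'i) cmatrix" where
  "mat_power I A 0 = id_mat"
| "mat_power I A (Suc n) = mat_mult I A (mat_power I A n)"

definition mat_powi :: "'i set \<Rightarrow> ('i, 'i) cmatrix \<Rightarrow> int \<Rightarrow> ('i, 'i) cmatrix" where
  "mat_powi I A t =
     (if t \<ge> 0 then mat_power I A (nat t) else mat_power I (mat_inverse I A) (nat (- t)))"

definition vec_norm :: "'i set \<Rightarrow> 'i cvector \<Rightarrow> real" where
  "vec_norm I x = L2_set (\<lambda>i. cmod (x i)) I"

text \<open>
  A graph is given by its vertex set \<open>V\<close> and its set \<open>E\<close> of two-element edges.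
\<close>

definition arcs :: "'v set set \<Rightarrow> ('v \<times> 'v) set" where
  "arcs E = {(u, v). {u, v} \<in> E}"

definition weighted_adjacency :: "'v set \<Rightarrow> 'v set set \<Rightarrow> ('v, 'v) cmatrix \<Rightarrow> bool" where
  "weighted_adjacency V E W \<longleftrightarrow> (\<forall>u\<in>V. \<forall>v\<in>V. W u v \<noteq> 0 \<longleftrightarrow> {u, v} \<in> E)"

definition arc_reversal :: "('v \<times> 'v, 'v \<times> 'v) cmatrix" where
  "arc_reversal = (\<lambda>(u, v) (x, y). if u = y \<and> v = x then 1 else 0)"

text \<open>
  The diagonal entries of \<open>W W\<^sup>*\<close> are non-negative reals, where \<open>csqrt\<close> is the
  usual square root.
\<close>

definition tail_incidence :: "'v set \<Rightarrow> ('v, 'v) cmatrix \<Rightarrow> ('v, 'v \<times> 'v) cmatrix" where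
  "tail_incidence V W = (\<lambda>u (a, b).
     if u = a then W a b / csqrt (mat_mult V W (conj_transpose W) a a) else 0)"

definition walk_matrix ::
  "'v set \<Rightarrow> 'v set set \<Rightarrow> ('v, 'v) cmatrix \<Rightarrow> ('v \<times> 'v, 'v \<times> 'v) cmatrix" where
  "walk_matrix V E W =
     mat_mult (arcs E) arc_reversal
       (\<lambda>p q. 2 * mat_mult V (conj_transpose (tail_incidence V W)) (tail_incidence V W) p q
               - id_mat p q)"

definition PGST :: "'i set \<Rightarrow> ('i, 'i) cmatrix \<Rightarrow> 'i cvector \<Rightarrow> 'i cvector \<Rightarrow> bool" where
  "PGST I U x y \<longleftrightarrow>
     (\<exists>\<gamma>::complex. cmod \<gamma> = 1 \<and>
        (\<forall>\<epsilon>>0. \<exists>t::int. vec_norm I (\<lambda>i. mat_vec I (mat_powi I U t) x i - \<gamma> * y i) < \<epsilon>))"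

definition vertex_state :: "'v set \<Rightarrow> ('v, 'v) cmatrix \<Rightarrow> 'v \<Rightarrow> ('v \<times> 'v) cvector" where
  "vertex_state V W a = mat_vec V (conj_transpose (tail_incidence V W)) (std_basis a)"

definition vertex_PGST ::
  "'v set \<Rightarrow> 'v set set \<Rightarrow> ('v, 'v) cmatrix \<Rightarrow> 'v \<Rightarrow> 'v \<Rightarrow> bool" where
  "vertex_PGST V E W a b \<longleftrightarrow>
     PGST (arcs E) (walk_matrix V E W) (vertex_state V W a) (vertex_state V W b)"

text \<open>
  An element of \<open>\<int>\<^sub>2\<^sup>d\<close> is a sequence of bits vanishing from index \<open>d\<close> on; subtraction is pointwise.
\<close>

definition cube_verts :: "nat \<Rightarrow> (nat \<Rightarrow> bit) set" where
  "cube_verts d = {u. \<forall>i\<ge>d. u i = 0}"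

definition cube_edges :: "nat \<Rightarrow> (nat \<Rightarrow> bit) set set" where
  "cube_edges d =
     {{u, v} | u v. u \<in> cube_verts d \<and> v \<in> cube_verts d \<and> (\<exists>j<d. u - v = std_basis j)}"

definition cube_weight :: "nat \<Rightarrow> nat \<Rightarrow> (nat \<Rightarrow> bit, nat \<Rightarrow> bit) cmatrix" where
  "cube_weight d m = (\<lambda>u v.
     if u - v = std_basis 0 then complex_of_real (sqrt (real m))
     else if \<exists>j\<in>{1..d - 1}. u - v = std_basis j then complex_of_real (sqrt 2)
     else 0)"

definition cube_zero :: "nat \<Rightarrow> bit" where
  "cube_zero = (\<lambda>i. 0)"

definition cube_ones :: "nat \<Rightarrow> nat \<Rightarrow> bit" where
  "cube_ones d = (\<lambda>i. if i < d then 1 else 0)"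

lemma bit_fun_diff_commute: "u - v = v - (u :: nat \<Rightarrow> bit)"
proof
  fix i show "(u - v) i = (v - u) i"
    by (cases "u i"; cases "v i") (simp_all add: fun_diff_def)
qed

lemma cube_edges_iff:
  assumes "u \<in> cube_verts d" "v \<in> cube_verts d"
  shows "{u, v} \<in> cube_edges d \<longleftrightarrow> (\<exists>j<d. u - v = std_basis j)"
proof
  assume "{u, v} \<in> cube_edges d"
  then obtain x y j where "{u, v} = {x, y}" "j < d" "x - y = std_basis j"
    unfolding cube_edges_def by blast
  then show "\<exists>j<d. u - v = std_basis j"
    by (metis bit_fun_diff_commute doubleton_eq_iff)
next
  assume "\<exists>j<d. u - v = std_basis j"
  then show "{u, v} \<in> cube_edges d"
    using assms unfolding cube_edges_def by blast
qed

lemma cube_weighted_adjacency: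
  assumes "d \<ge> 1" "m \<ge> 1"
  shows "weighted_adjacency (cube_verts d) (cube_edges d) (cube_weight d m)"
proof -
  have "j < d \<longleftrightarrow> j = 0 \<or> j \<in> {1..d - 1}" for j
    using assms(1) by auto
  then have "(\<exists>j<d. w = std_basis j) \<longleftrightarrow> w = std_basis 0 \<or> (\<exists>j\<in>{1..d - 1}. w = std_basis j)"
    for w :: "nat \<Rightarrow> bit"
    by metis
  then show ?thesis
    using assms unfolding weighted_adjacency_def
    by (auto simp: cube_edges_iff cube_weight_def)
qed

text \<open>
  The walk matrix is invertible, so its negative powers are the intended ones.
\<close>

lemma mat_inverse_walk_matrix:
  assumes fin: "finite V"
    and EV: "\<And>u v. {u, v} \<in> E \<Longrightarrow> u \<in> V \<and> v \<in> V"
    and W: "weighted_adjacency V E W"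
  shows "inverse_mats (arcs E) (walk_matrix V E W) (mat_inverse (arcs E) (walk_matrix V E W))"
proof -
  define N where "N = tail_incidence V W"
  define P where "P = mat_mult V (conj_transpose N) N"
  define C where "C = (\<lambda>p q. 2 * P p q - id_mat p q)"
  define D where "D = (\<lambda>a. \<Sum>y\<in>V. (cmod (W a y))\<^sup>2)"
  let ?A = "arcs E"
  have AV: "?A \<subseteq> V \<times> V"
    using EV by (auto simp: arcs_def)
  have finA: "finite ?A"
    using AV fin finite_subset by blast
  have swap: "prod.swap p \<in> ?A \<longleftrightarrow> p \<in> ?A" for p
    by (cases p) (auto simp: arcs_def insert_commute)
  have D: "mat_mult V W (conj_transpose W) a a = complex_of_real (D a)" for a
    by (simp add: mat_mult_def conj_transpose_def D_def complex_mult_cnj cmod_power2)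
  have D0: "D a \<ge> 0" for a
    by (simp add: D_def sum_nonneg)
  have csqrtD: "csqrt (mat_mult V W (conj_transpose W) a a) = complex_of_real (sqrt (D a))" for a
    by (simp only: D of_real_sqrt[OF D0])
  have N: "N u (a, b) = (if u = a then W a b / complex_of_real (sqrt (D a)) else 0)" for u a b
    by (simp add: N_def tail_incidence_def csqrtD)
  have P: "P (a, b) (c, e) = (if a = c then cnj (W a b) * W a e / complex_of_real (D a) else 0)"
    if "a \<in> V" for a b c e
  proof -
    have "P (a, b) (c, e) = (\<Sum>u\<in>V. if u = a then
        (if a = c then cnj (W a b) * W a e / complex_of_real (D a) else 0) else 0)"
      unfolding P_def mat_mult_def
    proof (rule sum.cong[OF refl])
      fix u
      have sq: "complex_of_real (sqrt (D c)) * complex_of_real (sqrt (D c)) = complex_of_real (D c)"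
        using D0[of c] by (simp flip: of_real_mult)
      show "conj_transpose N (a, b) u * N u (c, e) = (if u = a then
        (if a = c then cnj (W a b) * W a e / complex_of_real (D a) else 0) else 0)"
        using sq by (simp add: conj_transpose_def N)
    qed
    then show ?thesis
      using that fin by simp
  qed
  have PP: "(\<Sum>r\<in>?A. P p r * P r q) = P p q" if p: "p \<in> ?A" for p q
  proof -
    obtain a b c e where pq: "p = (a, b)" "q = (c, e)" by fastforce
    have a: "a \<in> V" "b \<in> V" using p AV pq by auto
    have "W a b \<noteq> 0"
      using p a W pq by (auto simp: arcs_def weighted_adjacency_def)
    then have Dpos: "D a \<noteq> 0"
      using a fin by (auto simp: D_def sum_nonneg_eq_0_iff)
    have "(\<Sum>r\<in>?A. P p r * P r q) = (\<Sum>r\<in>V \<times> V. P p r * P r q)"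
    proof (rule sum.mono_neutral_left)
      show "\<forall>r\<in>V \<times> V - ?A. P p r * P r q = 0"
      proof
        fix r assume r: "r \<in> V \<times> V - ?A"
        obtain x y where xy: "r = (x, y)" by fastforce
        have "W x y = 0"
          using r W by (auto simp: xy arcs_def weighted_adjacency_def)
        then show "P p r * P r q = 0"
          using a by (simp add: xy pq P)
      qed
    qed (use fin AV in auto)
    also have "\<dots> = (\<Sum>x\<in>V. \<Sum>y\<in>V. P p (x, y) * P (x, y) q)"
      by (simp add: sum.cartesian_product)
    also have "\<dots> = (\<Sum>x\<in>V. if x = a then \<Sum>y\<in>V. P p (a, y) * P (a, y) q else 0)"
      by (rule sum.cong) (auto simp: pq P a)
    also have "\<dots> = (\<Sum>y\<in>V. P p (a, y) * P (a, y) q)"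
      using a fin by simp
    also have "\<dots> = (\<Sum>y\<in>V. P p q / complex_of_real (D a) * complex_of_real ((cmod (W a y))\<^sup>2))"
      by (rule sum.cong) (auto simp: pq P a complex_norm_square[symmetric])
    also have "\<dots> = P p q / complex_of_real (D a) * complex_of_real (D a)"
      by (simp only: D_def of_real_sum flip: sum_distrib_left)
    finally show ?thesis using Dpos by simp
  qed
  have CC: "(\<Sum>r\<in>?A. C p r * C r q) = id_mat p q" if p: "p \<in> ?A" "q \<in> ?A" for p q
  proof -
    have id1: "(\<Sum>r\<in>?A. id_mat p r * F r) = F p" for F
    proof -
      have "(\<Sum>r\<in>?A. id_mat p r * F r) = (\<Sum>r\<in>?A. if p = r then F r else 0)"
        by (rule sum.cong) (auto simp: id_mat_def)
      then show ?thesis using p finA by simp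
    qed
    have id2: "(\<Sum>r\<in>?A. F r * id_mat r q) = F q" for F
    proof -
      have "(\<Sum>r\<in>?A. F r * id_mat r q) = (\<Sum>r\<in>?A. if r = q then F r else 0)"
        by (rule sum.cong) (auto simp: id_mat_def)
      then show ?thesis using p finA by simp
    qed
    have "(\<Sum>r\<in>?A. C p r * C r q) =
      (\<Sum>r\<in>?A. 4 * (P p r * P r q) - 2 * (P p r * id_mat r q) - 2 * (id_mat p r * P r q)
         + id_mat p r * id_mat r q)"
      by (rule sum.cong) (auto simp: C_def algebra_simps)
    also have "\<dots> = 4 * (\<Sum>r\<in>?A. P p r * P r q) - 2 * (\<Sum>r\<in>?A. P p r * id_mat r q)
        - 2 * (\<Sum>r\<in>?A. id_mat p r * P r q) + (\<Sum>r\<in>?A. id_mat p r * id_mat r q)"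
      by (simp only: sum.distrib sum_subtractf sum_distrib_left)
    also have "\<dots> = id_mat p q"
      by (simp add: PP[OF p(1)] id1 id2)
    finally show ?thesis .
  qed
  have U: "walk_matrix V E W p q = C (prod.swap p) q" if "p \<in> ?A" for p q
  proof -
    have "walk_matrix V E W p q = (\<Sum>r\<in>?A. if r = prod.swap p then C r q else 0)"
      unfolding walk_matrix_def mat_mult_def[of ?A] C_def P_def N_def
      by (rule sum.cong) (auto simp: arc_reversal_def split: prod.splits)
    then show ?thesis
      using that finA swap by simp
  qed
  define B where "B = (\<lambda>p q. C p (prod.swap q))"
  have "inverse_mats ?A (walk_matrix V E W) B"
    unfolding inverse_mats_def
  proof (intro ballI conjI)
    fix p q assume pq: "p \<in> ?A" "q \<in> ?A"
    have "mat_mult ?A (walk_matrix V E W) B p q =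
        (\<Sum>r\<in>?A. C (prod.swap p) r * C r (prod.swap q))"
      by (simp add: mat_mult_def U pq B_def)
    also have "\<dots> = id_mat p q"
      using pq swap CC by (cases p; cases q) (auto simp: id_mat_def)
    finally show "mat_mult ?A (walk_matrix V E W) B p q = id_mat p q" .
    have "mat_mult ?A B (walk_matrix V E W) p q =
        (\<Sum>r\<in>?A. C p (prod.swap r) * C (prod.swap r) q)"
      by (simp add: mat_mult_def U B_def)
    also have "\<dots> = (\<Sum>r\<in>?A. C p r * C r q)"
      by (rule sum.reindex_bij_witness[of _ prod.swap prod.swap]) (use swap in auto)
    also have "\<dots> = id_mat p q"
      using pq CC by simp
    finally show "mat_mult ?A B (walk_matrix V E W) p q = id_mat p q" .
  qed
  then show ?thesis
    unfolding mat_inverse_def by (metis someI)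
qed

lemma finite_cube_verts: "finite (cube_verts d)"
proof -
  have "(UNIV :: bit set) = {0, 1}"
    using bit.exhaust by auto
  then have "finite (UNIV :: bit set)"
    by (metis finite.emptyI finite_insert)
  then have "finite {u :: nat \<Rightarrow> bit. \<forall>i. (i \<in> {..<d} \<longrightarrow> u i \<in> UNIV) \<and> (i \<notin> {..<d} \<longrightarrow> u i = 0)}"
    by (intro finite_set_of_finite_funs) auto
  then show ?thesis
    by (simp add: cube_verts_def not_less)
qed

corollary mat_inverse_cube_walk:
  assumes "d \<ge> 1" "m \<ge> 1"
  defines "U \<equiv> walk_matrix (cube_verts d) (cube_edges d) (cube_weight d m)"
  shows "inverse_mats (arcs (cube_edges d)) U (mat_inverse (arcs (cube_edges d)) U)"
  unfolding U_def
proof (rule mat_inverse_walk_matrix)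
  show "u \<in> cube_verts d \<and> v \<in> cube_verts d" if "{u, v} \<in> cube_edges d" for u v
    using that by (auto simp: cube_edges_def doubleton_eq_iff)
qed (use assms finite_cube_verts cube_weighted_adjacency in auto)

end

theory Submission
  imports Defs
begin

text \<open>
  The vectors \<open>N\<^sup>* f\<close> with \<open>f\<close> a character of \<open>\<int>\<^sub>2\<^sup>d\<close> are mapped by \<open>N U\<^sup>t\<close> to \<open>cos (t \<theta>) f\<close>, where \<open>cos \<theta>\<close> is
  the eigenvalue of \<open>N R N\<^sup>*\<close> at \<open>f\<close>. As \<open>U\<close> is unitary, the transfer from \<open>0\<close> to \<open>1\<close> is good at time
  \<open>t\<close> as soon as \<open>cos (t \<theta>\<^sub>S)\<close> is close to \<open>(-1)\<^sup>|\<^sup>S\<^sup>|\<close> for all characters, indexed by \<open>S \<subseteq> {0, ..., d-1}\<close>.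

  For \<open>d > 2\<close> there is an odd prime \<open>p\<close> (namely \<open>d\<close> or \<open>2d - 2 + m\<close>) such that all eigenvalues are of the
  form \<open>1 - 2k/p\<close>, and replacing \<open>k\<close> by \<open>p - k\<close> replaces \<open>\<theta>\<^sub>k\<close> by \<open>\<pi> - \<theta>\<^sub>k\<close>. Picking one \<open>k\<close> from each pair
  \<open>{k, p - k}\<close>, the angles \<open>\<theta>\<^sub>k\<close> and \<open>\<pi>\<close> are linearly independent over the rationals, and Kronecker's
  theorem provides \<open>t\<close>, even with prescribed parity.

  For the independence, \<open>z\<^sub>k = exp (i \<theta>\<^sub>k)\<close> has norm 1 and lies in the quadratic field generated by
  \<open>\<surd>-k(p-k)\<close>. These fields are pairwise distinct, so sign-changing embeddings of their compositum
  reduce any multiplicative relation between the \<open>z\<^sub>k\<close> to one saying that a single \<open>z\<^sub>k\<close> is a root of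
  unity. This is impossible, because \<open>cos (n \<theta>\<^sub>k)\<close> has the denominator \<open>p\<^sup>n\<close> up to a power of 2.
\<close>

section \<open>Sign-changing embeddings of multiquadratic fields\<close>

text \<open>Embeddings are kept as total functions with an explicit carrier \<open>F\<close>,
  because the carrier grows along a tower of quadratic extensions. Closure under
  \<open>inverse\<close> covers 0 as well, since \<open>inverse 0 = 0\<close>.\<close>

definition subfield_hom :: "complex set \<Rightarrow> (complex \<Rightarrow> complex) \<Rightarrow> bool" where
  "subfield_hom F \<sigma> \<longleftrightarrow> 1 \<in> F \<and> \<sigma> 1 = 1 \<and>
     (\<forall>x\<in>F. inverse x \<in> F \<and>
       (\<forall>y\<in>F. x - y \<in> F \<and> x * y \<in> F \<and> \<sigma> (x + y) = \<sigma> x + \<sigma> y \<and> \<sigma> (x * y) = \<sigma> x * \<sigma> y))"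

lemma subfield_hom_simps:
  assumes "subfield_hom F \<sigma>"
  shows "0 \<in> F" "1 \<in> F" "\<sigma> 0 = 0" "\<sigma> 1 = 1"
    and "x \<in> F \<Longrightarrow> inverse x \<in> F" "x \<in> F \<Longrightarrow> - x \<in> F"
    and "x \<in> F \<Longrightarrow> y \<in> F \<Longrightarrow> x + y \<in> F" "x \<in> F \<Longrightarrow> y \<in> F \<Longrightarrow> x - y \<in> F"
    and "x \<in> F \<Longrightarrow> y \<in> F \<Longrightarrow> x * y \<in> F" "x \<in> F \<Longrightarrow> y \<in> F \<Longrightarrow> x / y \<in> F"
    and "x \<in> F \<Longrightarrow> y \<in> F \<Longrightarrow> \<sigma> (x + y) = \<sigma> x + \<sigma> y"
    and "x \<in> F \<Longrightarrow> y \<in> F \<Longrightarrow> \<sigma> (x * y) = \<sigma> x * \<sigma> y"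
    and "x \<in> F \<Longrightarrow> \<sigma> (- x) = - \<sigma> x"
    and "x \<in> F \<Longrightarrow> \<sigma> (inverse x) = inverse (\<sigma> x)"
proof -
  note h = assms[unfolded subfield_hom_def]
  show one: "1 \<in> F" "\<sigma> 1 = 1" using h by auto
  have diff: "x - y \<in> F" if "x \<in> F" "y \<in> F" for x y using h that by blast
  have mult: "x * y \<in> F" if "x \<in> F" "y \<in> F" for x y using h that by blast
  have inv: "inverse x \<in> F" if "x \<in> F" for x using h that by blast
  have hadd: "\<sigma> (x + y) = \<sigma> x + \<sigma> y" if "x \<in> F" "y \<in> F" for x y using h that by blast
  have hmult: "\<sigma> (x * y) = \<sigma> x * \<sigma> y" if "x \<in> F" "y \<in> F" for x y using h that by blast
  show zero: "0 \<in> F" using diff[OF one(1) one(1)] by simp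
  have neg: "- x \<in> F" if "x \<in> F" for x using diff[OF zero that] by simp
  show hzero: "\<sigma> 0 = 0" using hadd[OF zero zero] by simp
  have hneg: "\<sigma> (- x) = - \<sigma> x" if "x \<in> F" for x
    using hadd[OF that neg[OF that]] hzero by (simp add: eq_neg_iff_add_eq_0 add.commute)
  have hinv: "\<sigma> (inverse x) = inverse (\<sigma> x)" if "x \<in> F" for x
  proof (cases "x = 0")
    case False
    then have "\<sigma> x * \<sigma> (inverse x) = 1"
      using hmult[OF that inv[OF that]] one by simp
    then show ?thesis
      by (simp add: inverse_unique)
  qed (simp add: hzero)
  show "x \<in> F \<Longrightarrow> inverse x \<in> F" "x \<in> F \<Longrightarrow> - x \<in> F"
    "x \<in> F \<Longrightarrow> y \<in> F \<Longrightarrow> x - y \<in> F" "x \<in> F \<Longrightarrow> y \<in> F \<Longrightarrow> x * y \<in> F"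
    "x \<in> F \<Longrightarrow> y \<in> F \<Longrightarrow> \<sigma> (x + y) = \<sigma> x + \<sigma> y"
    "x \<in> F \<Longrightarrow> y \<in> F \<Longrightarrow> \<sigma> (x * y) = \<sigma> x * \<sigma> y"
    "x \<in> F \<Longrightarrow> \<sigma> (- x) = - \<sigma> x" "x \<in> F \<Longrightarrow> \<sigma> (inverse x) = inverse (\<sigma> x)"
    by (fact inv neg diff mult hadd hmult hneg hinv)+
  show "x + y \<in> F" if "x \<in> F" "y \<in> F" using diff[OF that(1) neg[OF that(2)]] by simp
  show "x / y \<in> F" if "x \<in> F" "y \<in> F"
    using mult[OF that(1) inv[OF that(2)]] by (simp add: divide_inverse)
qed

lemma subfield_hom_of_int:
  assumes "subfield_hom F \<sigma>"
  shows "of_int n \<in> F \<and> \<sigma> (of_int n) = of_int n"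
proof (induction n rule: int_induct[where k = 0])
  case (step2 i)
  have "of_int i + - 1 \<in> F" "\<sigma> (of_int i + - 1) = of_int i - 1"
    using step2 subfield_hom_simps[OF assms] by (metis, metis diff_conv_add_uminus)
  then show ?case by simp
qed (use subfield_hom_simps[OF assms] in auto)

lemma subfield_hom_Rats:
  assumes "subfield_hom F \<sigma>" "q \<in> \<rat>"
  shows "q \<in> F" "\<sigma> q = q"
proof -
  obtain a b where q: "q = of_int a / of_int b"
    using assms(2) by (metis Rats_cases')
  note s = subfield_hom_simps[OF assms(1)] and i = subfield_hom_of_int[OF assms(1)]
  show "q \<in> F" unfolding q using s(10) i by blast
  show "\<sigma> q = q"
    unfolding q divide_inverse using s(5,12,14) i by simp
qed

lemma subfield_hom_powi:
  assumes "subfield_hom F \<sigma>" "x \<in> F"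
  shows "x powi n \<in> F \<and> \<sigma> (x powi n) = \<sigma> x powi n"
proof -
  note s = subfield_hom_simps[OF assms(1)]
  have "y ^ k \<in> F \<and> \<sigma> (y ^ k) = \<sigma> y ^ k" if "y \<in> F" for y k
    using that s by (induction k) auto
  then show ?thesis
    using assms(2) s by (auto simp: power_int_def)
qed

lemma subfield_hom_prod:
  assumes "subfield_hom F \<sigma>" "\<And>k. k \<in> S \<Longrightarrow> f k \<in> F"
  shows "prod f S \<in> F \<and> \<sigma> (prod f S) = (\<Prod>k\<in>S. \<sigma> (f k))"
  using assms(2) subfield_hom_simps[OF assms(1)]
  by (induction S rule: infinite_finite_induct) auto

lemma subfield_hom_Rats_id: "subfield_hom \<rat> (\<lambda>x. x)"
  by (simp add: subfield_hom_def)

text \<open>Since \<open>r \<notin> F\<close>, the elements of \<open>F(r)\<close> have unique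
  coordinates in the basis 1, \<open>r\<close>. Both \<open>r\<close> and \<open>s\<close> square to
  the integer \<open>c\<close>, which \<open>\<sigma>\<close> fixes, so sending
  \<open>x + y * r\<close> to \<open>\<sigma> x + \<sigma> y * s\<close> respects products.\<close>

lemma subfield_hom_extend:
  assumes h: "subfield_hom F \<sigma>" and r: "r * r = of_int c" "r \<notin> F" and s: "s * s = of_int c"
  obtains \<tau> where "subfield_hom {x + y * r |x y. x \<in> F \<and> y \<in> F} \<tau>"
    "\<And>x. x \<in> F \<Longrightarrow> \<tau> x = \<sigma> x" "\<tau> r = s"
proof -
  note sm = subfield_hom_simps[OF h] and si = subfield_hom_of_int[OF h]
  let ?K = "{x + y * r |x y. x \<in> F \<and> y \<in> F}"
  have uniq: "x = x' \<and> y = y'"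
    if "x + y * r = x' + y' * r" "x \<in> F" "y \<in> F" "x' \<in> F" "y' \<in> F" for x y x' y'
  proof -
    have "y = y'"
    proof (rule ccontr)
      assume "y \<noteq> y'"
      then have "r = (x' - x) / (y - y')"
        using that(1) by (simp add: field_simps)
      then show False using that r(2) sm by metis
    qed
    then show ?thesis using that(1) by simp
  qed
  define \<tau> where "\<tau> z = (THE w. \<exists>x\<in>F. \<exists>y\<in>F. z = x + y * r \<and> w = \<sigma> x + \<sigma> y * s)" for z
  have \<tau>: "\<tau> (x + y * r) = \<sigma> x + \<sigma> y * s" if "x \<in> F" "y \<in> F" for x y
    unfolding \<tau>_def using that by (intro the_equality) (auto dest: uniq)
  have KI: "z \<in> ?K" if "z = x + y * r" "x \<in> F" "y \<in> F" for x y z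
    using that by blast
  have "subfield_hom ?K \<tau>"
    unfolding subfield_hom_def
  proof (intro conjI ballI)
    show "1 \<in> ?K" by (rule KI[of _ 1 0]) (use sm in auto)
    show "\<tau> 1 = 1" using \<tau>[of 1 0] sm by simp
  next
    fix z assume "z \<in> ?K"
    then obtain x y where z: "z = x + y * r" "x \<in> F" "y \<in> F" by blast
    show "inverse z \<in> ?K"
    proof (cases "z = 0")
      case True
      then show ?thesis by (intro KI[of _ 0 0]) (use sm in auto)
    next
      case False
      \<comment> \<open>The conjugate of \<open>z\<close> is nonzero by uniqueness of coordinates;
        with the norm \<open>D\<close> of \<open>z\<close>, the inverse arises by rationalising the
        denominator.\<close>
      have "x - y * r \<noteq> 0"
      proof
        assume "x - y * r = 0"
        then have "x = 0 \<and> y = 0"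
          using uniq[of x "- y" 0 0] z sm by auto
        then show False using False z by simp
      qed
      moreover define D where "D = x * x - y * y * of_int c"
      moreover have "z * (x - y * r) = D"
        unfolding D_def r(1)[symmetric] z by (simp add: algebra_simps)
      ultimately have "inverse z = (x - y * r) / D"
        using False by (metis divide_inverse inverse_mult_distrib mult.commute mult_cancel_left
            right_inverse mult.assoc mult.right_neutral)
      then have "inverse z = x / D + (- y / D) * r"
        by (simp add: diff_divide_distrib)
      moreover have "D \<in> F" unfolding D_def using z sm si by auto
      ultimately show ?thesis using z by (intro KI[of _ "x / D" "- y / D"] sm) auto
    qed
    fix w assume "w \<in> ?K"
    then obtain u v where w: "w = u + v * r" "u \<in> F" "v \<in> F" by blast
    have d: "z - w = (x - u) + (y - v) * r" and a: "z + w = (x + u) + (y + v) * r"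
      unfolding z w by (simp_all add: algebra_simps)
    have m: "z * w = (x * u + y * v * of_int c) + (x * v + y * u) * r"
      unfolding z w r(1)[symmetric] by (simp add: algebra_simps)
    have mF: "x * u + y * v * of_int c \<in> F" "x * v + y * u \<in> F"
      using z w sm si by auto
    show "z - w \<in> ?K" by (rule KI[OF d]) (use z w sm in auto)
    show "z * w \<in> ?K" by (rule KI[OF m mF])
    show "\<tau> (z + w) = \<tau> z + \<tau> w"
      unfolding a using z w sm by (simp add: \<tau> distrib_right[of "\<sigma> y"])
    have "\<tau> (z * w) = (\<sigma> x * \<sigma> u + \<sigma> y * \<sigma> v * of_int c) + (\<sigma> x * \<sigma> v + \<sigma> y * \<sigma> u) * s"
      unfolding m \<tau>[OF mF] using z w sm si by simp
    then show "\<tau> (z * w) = \<tau> z * \<tau> w"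
      unfolding z w s[symmetric] \<tau>[OF z(2,3)] \<tau>[OF w(2,3)] by (simp add: algebra_simps)
  qed
  moreover have "\<tau> x = \<sigma> x" if "x \<in> F" for x using \<tau>[of x 0] that sm by simp
  moreover have "\<tau> r = s" using \<tau>[of 0 1] sm by simp
  ultimately show ?thesis using that by blast
qed

text \<open>The square roots are adjoined one at a time: one already in the field changes nothing,
  any other is sent to itself.\<close>

lemma subfield_hom_extend_finite:
  assumes h: "subfield_hom F \<sigma>" and R: "finite R" "\<And>r. r \<in> R \<Longrightarrow> r * r \<in> \<int>"
  shows "\<exists>K \<tau>. subfield_hom K \<tau> \<and> F \<union> R \<subseteq> K \<and> (\<forall>x\<in>F. \<tau> x = \<sigma> x)"
  using R
proof (induction R rule: finite_induct)
  case empty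
  then show ?case using h by auto
next
  case (insert r R)
  then obtain K \<tau> where K: "subfield_hom K \<tau>" "F \<union> R \<subseteq> K" "\<And>x. x \<in> F \<Longrightarrow> \<tau> x = \<sigma> x"
    by auto
  show ?case
  proof (cases "r \<in> K")
    case True
    then show ?thesis using K by blast
  next
    case False
    obtain c where c: "r * r = of_int c" using insert.prems Ints_cases by (metis insertI1)
    from subfield_hom_extend[OF K(1) c False c]
    obtain \<rho> where \<rho>: "subfield_hom {x + y * r |x y. x \<in> K \<and> y \<in> K} \<rho>"
        "\<And>x. x \<in> K \<Longrightarrow> \<rho> x = \<tau> x"
      by blast
    let ?L = "{x + y * r |x y. x \<in> K \<and> y \<in> K}"
    have "x \<in> ?L" if "x \<in> K" for x
      using that subfield_hom_simps(1)[OF K(1)] by (intro CollectI exI[of _ x] exI[of _ 0]) simp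
    moreover have "r \<in> ?L"
      using subfield_hom_simps(1,2)[OF K(1)]
      by (intro CollectI exI[of _ 0] exI[of _ 1]) simp
    ultimately have "F \<union> insert r R \<subseteq> ?L"
      using K(2) by blast
    then show ?thesis
      using \<rho> K(2,3) by (intro exI[of _ ?L] exI[of _ \<rho>]) auto
  qed
qed

text \<open>Extend from \<open>\<rat>\<close> to \<open>\<rat>(u)\<close> fixing \<open>u\<close>,
  then adjoin \<open>v\<close> and send it to \<open>- v\<close>, which is possible because
  \<open>v\<close> lies outside \<open>\<rat>(u)\<close>. The rest of \<open>R\<close> is adjoined
  afterwards, with no control over its images.\<close>

lemma sign_change_hom:
  assumes "finite R" "\<And>r. r \<in> R \<Longrightarrow> r * r \<in> \<int>" "u \<in> R" "v \<in> R"
    and "u \<notin> \<rat>" "v \<notin> {x + y * u |x y. x \<in> \<rat> \<and> y \<in> \<rat>}"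
  obtains F \<sigma> where "subfield_hom F \<sigma>" "R \<subseteq> F" "\<sigma> u = u" "\<sigma> v = - v"
proof -
  obtain c where c: "u * u = of_int c" using assms Ints_cases by metis
  obtain e where e: "v * v = of_int e" using assms Ints_cases by metis
  let ?F1 = "{x + y * u |x y. x \<in> \<rat> \<and> y \<in> \<rat>}"
  from subfield_hom_extend[OF subfield_hom_Rats_id c assms(5) c]
  obtain \<tau>1 where 1: "subfield_hom ?F1 \<tau>1" "\<tau>1 u = u" by blast
  let ?F2 = "{x + y * v |x y. x \<in> ?F1 \<and> y \<in> ?F1}"
  have "(- v) * (- v) = of_int e" using e by simp
  from subfield_hom_extend[OF 1(1) e assms(6) this]
  obtain \<tau>2 where 2: "subfield_hom ?F2 \<tau>2" "\<And>x. x \<in> ?F1 \<Longrightarrow> \<tau>2 x = \<tau>1 x" "\<tau>2 v = - v" by blast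
  have F1: "0 \<in> ?F1" "1 \<in> ?F1"
    using subfield_hom_simps[OF 1(1)] by blast+
  have "u = 0 + 1 * u" by simp
  then have u: "u \<in> ?F1" by (metis (mono_tags, lifting) Rats_0 Rats_1 mem_Collect_eq)
  have "u = u + 0 * v" "v = 0 + 1 * v" by simp_all
  then have uv: "u \<in> ?F2" "v \<in> ?F2"
    using u F1 by blast+
  obtain K \<tau> where K: "subfield_hom K \<tau>" "?F2 \<union> R \<subseteq> K" "\<forall>x\<in>?F2. \<tau> x = \<tau>2 x"
    using subfield_hom_extend_finite[OF 2(1) assms(1,2)] by blast
  show ?thesis
  proof (rule that[OF K(1)])
    show "R \<subseteq> K" using K(2) by blast
    show "\<tau> u = u" using bspec[OF K(3) uv(1)] 2(2)[OF u] 1(2) by simp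
    show "\<tau> v = - v" using bspec[OF K(3) uv(2)] 2(3) by simp
  qed
qed

text \<open>
  If \<open>\<sigma>\<close> fixes \<open>\<surd>-\<delta>\<^sub>i\<close> and negates \<open>\<surd>-\<delta>\<^sub>j\<close>, multiplying a relation by its image under \<open>\<sigma>\<close>
  doubles the exponent of \<open>z\<^sub>i\<close> and kills that of \<open>z\<^sub>j\<close>, since \<open>\<sigma>\<close> either fixes or inverts each \<open>z\<^sub>k\<close>.
\<close>

lemma unimodular_relation_imp_root_of_unity:
  fixes \<delta> :: "'k \<Rightarrow> nat" and z :: "'k \<Rightarrow> complex" and l :: "'k \<Rightarrow> int"
  defines "r \<equiv> \<lambda>k. \<i> * complex_of_real (sqrt (real (\<delta> k)))"
  assumes "finite S" and \<delta>: "\<And>k. k \<in> S \<Longrightarrow> \<delta> k > 0"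
    and z: "\<And>k. k \<in> S \<Longrightarrow> x k \<in> \<rat> \<and> y k \<in> \<rat> \<and>
      z k = complex_of_real (x k) + complex_of_real (y k) * r k \<and> cmod (z k) = 1"
    and indep: "\<And>j k. j \<in> S \<Longrightarrow> k \<in> S \<Longrightarrow> j \<noteq> k \<Longrightarrow> r k \<notin> {a + b * r j |a b. a \<in> \<rat> \<and> b \<in> \<rat>}"
    and rel: "(\<Prod>k\<in>S. z k powi l k) = 1" and i: "i \<in> S"
  shows "\<exists>n>0. z i powi (of_nat n * l i) = 1"
proof -
  have rr: "r k * r k = - of_nat (\<delta> k)" for k
    unfolding r_def by (simp add: algebra_simps flip: of_real_mult)
  have irr: "r k \<notin> \<rat>" if "k \<in> S" for k
  proof
    assume "r k \<in> \<rat>"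
    then have "r k \<in> \<real>" by (metis Rats_cases' Reals_divide Reals_of_int)
    then show False using \<delta>[OF that] by (simp add: r_def complex_is_Real_iff)
  qed
  have znz: "z k \<noteq> 0" if "k \<in> S" for k using z[OF that] by auto
  \<comment> \<open>\<open>T\<close> collects the indices whose exponents have been cleared;
    clearing each one doubles the exponent of \<open>z i\<close>.\<close>
  have "\<exists>l'. l' i = 2 ^ card T * l i \<and> (\<forall>k\<in>T. l' k = 0) \<and> (\<Prod>k\<in>S. z k powi l' k) = 1"
    if "T \<subseteq> S - {i}" for T
    using finite_subset[OF that finite_Diff[OF \<open>finite S\<close>]] that
  proof (induction T rule: finite_induct)
    case empty
    show ?case using rel by (intro exI[of _ l]) auto
  next
    case (insert j T)
    then obtain l' where l': "l' i = 2 ^ card T * l i" "\<And>k. k \<in> T \<Longrightarrow> l' k = 0"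
        "(\<Prod>k\<in>S. z k powi l' k) = 1" by auto
    have j: "j \<in> S" "j \<noteq> i" using insert by auto
    obtain F \<sigma> where \<sigma>: "subfield_hom F \<sigma>" "r ` S \<subseteq> F" "\<sigma> (r i) = r i" "\<sigma> (r j) = - r j"
    proof (rule sign_change_hom[of "r ` S" "r i" "r j"])
      show "u * u \<in> \<int>" if "u \<in> r ` S" for u using that by (auto simp: rr)
      show "r j \<notin> {a + b * r i |a b. a \<in> \<rat> \<and> b \<in> \<rat>}" by (rule indep) (use i j in auto)
    qed (use \<open>finite S\<close> i j irr in auto)
    note s = subfield_hom_simps[OF \<sigma>(1)]
    have sr: "\<sigma> (r k) = r k \<or> \<sigma> (r k) = - r k" if "k \<in> S" for k
    proof -
      have k: "r k \<in> F" using \<sigma>(2) that by auto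
      have "\<sigma> (r k) * \<sigma> (r k) = \<sigma> (of_int (- int (\<delta> k)))"
        using s(12)[OF k k] rr[of k] by simp
      also have "\<dots> = r k * r k"
        by (simp only: subfield_hom_of_int[OF \<sigma>(1)] rr) simp
      finally show ?thesis by (simp add: square_eq_iff)
    qed
    \<comment> \<open>As \<open>z k\<close> has modulus 1, conjugation inverts it, so the sign in
      \<open>\<sigma> (r k)\<close> reappears as an exponent 1 or -1 of \<open>z k\<close>.\<close>
    define \<eta> :: "'k \<Rightarrow> int" where "\<eta> k = (if \<sigma> (r k) = r k then 1 else - 1)" for k
    have zF: "z k \<in> F" and sz: "\<sigma> (z k) = z k powi \<eta> k" if "k \<in> S" for k
    proof -
      have k: "r k \<in> F" using \<sigma>(2) that by auto
      have q: "complex_of_real q \<in> \<rat>" if "q \<in> \<rat>" for q using that by (auto elim!: Rats_cases')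
      have xy: "complex_of_real (x k) \<in> \<rat>" "complex_of_real (y k) \<in> \<rat>"
        using z[OF that] q by auto
      note xyF = subfield_hom_Rats[OF \<sigma>(1) xy(1)] subfield_hom_Rats[OF \<sigma>(1) xy(2)]
      show "z k \<in> F" using z[OF that] xyF k s by metis
      have e: "\<sigma> (z k) = x k + y k * \<sigma> (r k)"
        using z[OF that] xyF k s by simp
      show "\<sigma> (z k) = z k powi \<eta> k"
      proof (cases "\<sigma> (r k) = r k")
        case True
        then show ?thesis using e z[OF that] by (simp add: \<eta>_def)
      next
        case False
        then have "\<sigma> (z k) = x k - y k * r k" using e sr[OF that] by auto
        also have "\<dots> = cnj (z k)" using z[OF that] by (simp add: r_def)
        also have "\<dots> = inverse (z k)"
          using conjunct2[OF conjunct2[OF conjunct2[OF z[OF that]]]] complex_div_cnj[of 1 "z k"]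
          by (simp add: inverse_eq_divide)
        finally show ?thesis using False by (simp add: \<eta>_def power_int_minus)
      qed
    qed
    \<comment> \<open>These are the exponents of the relation times its image: cleared indices stay
      at 0, \<open>i\<close> gets the factor 2 and \<open>j\<close> the factor 0.\<close>
    define l2 where "l2 k = (1 + \<eta> k) * l' k" for k
    have "1 = \<sigma> (\<Prod>k\<in>S. z k powi l' k)"
      using l'(3) s by simp
    also have "\<dots> = (\<Prod>k\<in>S. \<sigma> (z k powi l' k))"
      by (rule subfield_hom_prod[OF \<sigma>(1), THEN conjunct2])
        (use subfield_hom_powi[OF \<sigma>(1)] zF in blast)
    also have "\<dots> = (\<Prod>k\<in>S. z k powi (\<eta> k * l' k))"
    proof (rule prod.cong[OF refl])
      fix k assume k: "k \<in> S"
      show "\<sigma> (z k powi l' k) = z k powi (\<eta> k * l' k)"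
        using subfield_hom_powi[OF \<sigma>(1) zF[OF k]] sz[OF k] by (simp add: power_int_mult)
    qed
    finally have "(\<Prod>k\<in>S. z k powi l' k) * (\<Prod>k\<in>S. z k powi (\<eta> k * l' k)) = 1"
      using l'(3) by simp
    moreover have "(\<Prod>k\<in>S. z k powi l' k) * (\<Prod>k\<in>S. z k powi (\<eta> k * l' k)) =
        (\<Prod>k\<in>S. z k powi l2 k)"
      unfolding l2_def prod.distrib[symmetric]
      by (intro prod.cong) (auto simp: znz power_int_add distrib_right)
    ultimately have "(\<Prod>k\<in>S. z k powi l2 k) = 1" by simp
    moreover have "r j \<noteq> 0" using irr[OF j(1)] by auto
    then have "\<eta> i = 1" "\<eta> j = - 1"
      using \<sigma>(3,4) by (auto simp: \<eta>_def)
    then have "l2 i = 2 ^ card (insert j T) * l i" "\<forall>k\<in>insert j T. l2 k = 0"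
      using l' insert.hyps by (auto simp: l2_def)
    ultimately show ?case by blast
  qed
  from this[OF subset_refl] obtain l' where l': "l' i = 2 ^ card (S - {i}) * l i"
      "\<And>k. k \<in> S - {i} \<Longrightarrow> l' k = 0" "(\<Prod>k\<in>S. z k powi l' k) = 1"
    by auto
  have "(\<Prod>k\<in>S. z k powi l' k) = z i powi l' i * (\<Prod>k\<in>S-{i}. z k powi l' k)"
    using \<open>finite S\<close> i by (rule prod.remove)
  also have "(\<Prod>k\<in>S-{i}. z k powi l' k) = 1"
    using l'(2) by (intro prod.neutral) auto
  finally show ?thesis
    using l' by (intro exI[of _ "2 ^ card (S - {i})"]) simp
qed

section \<open>Independence of the angles\<close>

text \<open>
  With \<open>x = p - 2j\<close>, \<open>y = p - 2k\<close> and \<open>s\<close> the supposed square root, the two numbers \<open>(xy \<plusminus> 4s) / p\<^sup>2\<close>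
  are the cosines of \<open>\<theta>\<^sub>j \<mp> \<theta>\<^sub>k\<close>. Modulo \<open>p\<close> exactly one numerator vanishes, so that one is an odd
  multiple of \<open>p\<^sup>2\<close> and the cosine is \<open>1\<close> or \<open>-1\<close>, whence \<open>\<theta>\<^sub>j \<mp> \<theta>\<^sub>k\<close> is a multiple of \<open>\<pi>\<close>.
\<close>

lemma product_of_norms_not_square:
  fixes p j k s :: int
  assumes p: "prime p" "odd p" and j: "0 < j" "j < p" and k: "0 < k" "k < p"
    and jk: "j \<noteq> k" "j + k \<noteq> p"
  shows "s\<^sup>2 \<noteq> (j * (p - j)) * (k * (p - k))"
proof
  assume s: "s\<^sup>2 = (j * (p - j)) * (k * (p - k))"
  define x y a b where "x = p - 2 * j" and "y = p - 2 * k" and "a = j * (p - j)" and "b = k * (p - k)"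
  have xa: "x\<^sup>2 = p\<^sup>2 - 4 * a" and yb: "y\<^sup>2 = p\<^sup>2 - 4 * b"
    unfolding x_def y_def a_def b_def by (simp_all add: power2_eq_square algebra_simps)
  have sab: "s\<^sup>2 = a * b" using s by (simp add: a_def b_def)
  have key: "(x * y - 4 * s) * (x * y + 4 * s) = p\<^sup>2 * (x\<^sup>2 + y\<^sup>2 - p\<^sup>2)"
  proof -
    have "(x * y - 4 * s) * (x * y + 4 * s) = x\<^sup>2 * y\<^sup>2 - 16 * s\<^sup>2"
      by (simp add: power2_eq_square algebra_simps)
    also have "\<dots> = p\<^sup>2 * (x\<^sup>2 + y\<^sup>2 - p\<^sup>2)"
      unfolding sab xa yb by (simp add: algebra_simps power2_eq_square)
    finally show ?thesis .
  qed
  have nd: "\<not> p dvd n" if "0 < n" "n < p" for n using that zdvd_imp_le by fastforce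
  have ps: "\<not> p dvd s"
  proof
    assume "p dvd s"
    then have "p dvd j * (p - j) * (k * (p - k))" using s by (metis dvd_power_iff dvd_mult power2_eq_square)
    then show False using nd j k p(1) by (simp add: prime_dvd_mult_iff)
  qed
  have "p \<noteq> 2" using p(2) by auto
  then have p2: "\<not> p dvd 2" using nd[of 2] zdvd_imp_le[of p 2] prime_ge_2_int[OF p(1)] by auto
  have p8: "\<not> p dvd 8 * s"
  proof
    assume "p dvd 8 * s"
    then have "p dvd 2 * (2 * (2 * s))" by simp
    then show False using ps p2 p(1) by (simp only: prime_dvd_mult_iff simp_thms)
  qed
  have main: False if t: "t\<^sup>2 = a * b" and d: "p\<^sup>2 dvd x * y - 4 * t" for t
  proof -
    obtain c where c: "x * y - 4 * t = p\<^sup>2 * c" using d by blast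
    \<comment> \<open>The numbers \<open>x\<close> and \<open>y\<close> are odd because
      \<open>p\<close> is, so the numerator is nonzero. The cosine in question is the integer
      \<open>c\<close>, hence at least 1 in absolute value; the contradiction will be
      \<open>c\<^sup>2 < 1\<close>.\<close>
    have "odd (x * y - 4 * t)" using p(2) by (simp add: x_def y_def)
    then have c0: "c \<noteq> 0" using c by auto
    define P where "P = x\<^sup>2 * b + y\<^sup>2 * a"
    define Q where "Q = 2 * x * y * t"
    \<comment> \<open>The left side is \<open>p^4\<close> times the squared sine. With
      \<open>t\<close> a square root of \<open>a * b\<close> of either sign, \<open>P + Q\<close> is
      the expanded square of \<open>x * sqrt b \<plusminus> y * sqrt a\<close>, written without
      leaving the integers.\<close>
    have PQ: "p^4 - (x * y - 4 * t)\<^sup>2 = 4 * (P + Q)"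
    proof -
      have "(x * y - 4 * t)\<^sup>2 = x\<^sup>2 * y\<^sup>2 + 16 * t\<^sup>2 - 4 * Q"
        by (simp add: Q_def power2_eq_square algebra_simps)
      moreover have "x\<^sup>2 * y\<^sup>2 + 16 * t\<^sup>2 = p^4 - 4 * P"
        unfolding t P_def xa yb by (simp add: algebra_simps power2_eq_square power4_eq_xxxx)
      ultimately show ?thesis by simp
    qed
    have sq: "P\<^sup>2 - Q\<^sup>2 = (x\<^sup>2 * b - y\<^sup>2 * a)\<^sup>2"
    proof -
      have "Q\<^sup>2 = 4 * x\<^sup>2 * y\<^sup>2 * (a * b)" unfolding t[symmetric] Q_def by (simp add: power_mult_distrib)
      then show ?thesis by (simp add: P_def power2_eq_square algebra_simps)
    qed
    have ab: "a > 0" "b > 0" using j k by (simp_all add: a_def b_def)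
    then have P0: "P \<ge> 0" by (simp add: P_def)
    have "Q\<^sup>2 \<le> P\<^sup>2" using sq by (metis diff_ge_0_iff_ge zero_le_power2)
    then have "\<bar>Q\<bar> \<le> P" using P0 by (metis abs_le_square_iff abs_of_nonneg)
    \<comment> \<open>Vanishing would force \<open>a = b\<close>, that is, \<open>k = j\<close> or
      \<open>k = p - j\<close>.\<close>
    moreover have "P + Q \<noteq> 0"
    proof
      assume "P + Q = 0"
      then have "P\<^sup>2 = Q\<^sup>2" by (simp add: add_eq_0_iff)
      then have "x\<^sup>2 * b = y\<^sup>2 * a" using sq by simp
      then have "(p\<^sup>2 - 4 * a) * b = (p\<^sup>2 - 4 * b) * a" by (simp only: xa yb)
      then have "p\<^sup>2 * b = p\<^sup>2 * a" by (simp add: algebra_simps)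
      then have "a = b" using p(2) by auto
      then have "(j - k) * (p - (j + k)) = 0" by (simp add: a_def b_def algebra_simps)
      then show False using jk by simp
    qed
    ultimately have "P + Q > 0" by linarith
    then have "(p\<^sup>2 * c)\<^sup>2 < p^4" using PQ c by simp
    then have "p^4 * c\<^sup>2 < p^4 * 1" by (simp add: power_mult_distrib flip: power_mult)
    moreover have "p^4 > 0" using prime_gt_0_int[OF p(1)] by simp
    ultimately have "c\<^sup>2 < 1" by (simp only: mult_less_cancel_left_pos)
    moreover have "c\<^sup>2 > 0" using c0 by simp
    ultimately show False by linarith
  qed
  have "p\<^sup>2 dvd x * y - 4 * s \<or> p\<^sup>2 dvd x * y - 4 * (- s)"
  proof (cases "p dvd x * y - 4 * s")
    case True
    have "\<not> p dvd x * y + 4 * s"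
    proof
      assume "p dvd x * y + 4 * s"
      then have "p dvd (x * y + 4 * s) - (x * y - 4 * s)" using True by (rule dvd_diff)
      then show False using p8 by simp
    qed
    then have "coprime (p\<^sup>2) (x * y + 4 * s)"
      using p(1) prime_imp_coprime by auto
    then have "p\<^sup>2 dvd x * y - 4 * s"
      using key coprime_dvd_mult_left_iff by (metis dvd_triv_left)
    then show ?thesis ..
  next
    case False
    then have "coprime (p\<^sup>2) (x * y - 4 * s)"
      using p(1) prime_imp_coprime by auto
    then have "p\<^sup>2 dvd x * y + 4 * s"
      using key coprime_dvd_mult_right_iff by (metis dvd_triv_left)
    then show ?thesis by simp
  qed
  then show False using main[of s] main[of "- s"] sab by auto
qed

text \<open>Comparing imaginary parts gives \<open>sqrt b = v * sqrt a\<close> with \<open>v\<close>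
  rational, so \<open>sqrt (a * b) = v * a\<close> is rational. Being an algebraic integer, it is an
  integer, against \<open>ns\<close>.\<close>

lemma imaginary_quadratic_notin:
  fixes a b :: nat
  assumes ns: "\<And>s::int. s\<^sup>2 \<noteq> int a * int b"
  shows "\<i> * complex_of_real (sqrt (real b)) \<notin>
    {x + y * (\<i> * complex_of_real (sqrt (real a))) |x y. x \<in> \<rat> \<and> y \<in> \<rat>}"
proof
  assume "\<i> * complex_of_real (sqrt (real b)) \<in>
    {x + y * (\<i> * complex_of_real (sqrt (real a))) |x y. x \<in> \<rat> \<and> y \<in> \<rat>}"
  then obtain x y where xy: "x \<in> \<rat>" "y \<in> \<rat>"
    and e: "\<i> * complex_of_real (sqrt (real b)) = x + y * (\<i> * complex_of_real (sqrt (real a)))"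
    by blast
  have rat: "\<exists>q\<in>\<rat>. z = complex_of_real q" if "z \<in> \<rat>" for z
    using that by (metis Rats_cases' Rats_divide Rats_of_int of_real_divide of_real_of_int_eq)
  obtain u v where uv: "x = complex_of_real u" "y = complex_of_real v" "v \<in> \<rat>"
    using rat xy by metis
  have "sqrt (real b) = v * sqrt (real a)"
    using arg_cong[OF e, of Im] uv by simp
  then have "sqrt (real (a * b)) = v * real a"
    by (simp add: real_sqrt_mult)
  then have "sqrt (real (a * b)) \<in> \<rat>" using uv by simp
  moreover have "algebraic_int (sqrt (real (a * b)))"
    by (intro algebraic_int_sqrt int_imp_algebraic_int) auto
  ultimately have "sqrt (real (a * b)) \<in> \<int>"
    using rational_algebraic_int_is_int by blast
  then obtain s where "sqrt (real (a * b)) = of_int s" using Ints_cases by blast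
  then have "real_of_int (s\<^sup>2) = real (a * b)"
    by (metis of_int_power of_nat_0_le_iff real_sqrt_pow2)
  then have "real_of_int (s\<^sup>2) = real_of_int (int a * int b)" by simp
  then show False using ns of_int_eq_iff by blast
qed

text \<open>The numbers \<open>c n = 2 * p ^ n * cos (n * \<theta>)\<close> start with 2 and
  \<open>2 * x\<close> and satisfy the Chebyshev recurrence
  \<open>c (n + 2) = 2 * x * c (n + 1) - p\<^sup>2 * c n\<close>. Two consecutive terms are carried
  through the induction. The congruence modulo \<open>p\<close> starts at index 1, as
  \<open>c 0\<close> is 2 and not 1.\<close>

lemma cos_multiple_numerator:
  fixes \<theta> :: real and x p :: int
  assumes "p > 0" and "of_int p * cos \<theta> = of_int x"
  shows "\<exists>a b::int. 2 * of_int p ^ Suc n * cos (real (Suc n) * \<theta>) = of_int a \<and>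
    2 * of_int p ^ n * cos (real n * \<theta>) = of_int b \<and> p dvd a - (2 * x) ^ Suc n"
proof (induction n)
  case 0
  show ?case
    using assms by (intro exI[of _ "2 * x"] exI[of _ 2]) (simp add: mult.assoc)
next
  case (Suc n)
  then obtain a b :: int where a: "2 * of_int p ^ Suc n * cos (real (Suc n) * \<theta>) = of_int a"
    and b: "2 * of_int p ^ n * cos (real n * \<theta>) = of_int b" and c: "p dvd a - (2 * x) ^ Suc n"
    by blast
  define C where "C = cos (real (Suc n) * \<theta>)"
  define C' where "C' = cos (real n * \<theta>)"
  have "cos (real (Suc (Suc n)) * \<theta>) + C' = 2 * cos \<theta> * C"
    using cos_times_cos[of \<theta> "real (Suc n) * \<theta>"] unfolding C_def C'_def
    by (simp add: algebra_simps cos_add cos_diff)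
  then have rec: "cos (real (Suc (Suc n)) * \<theta>) = 2 * cos \<theta> * C - C'" by simp
  have "2 * of_int p ^ Suc (Suc n) * cos (real (Suc (Suc n)) * \<theta>) =
     2 * (of_int p * cos \<theta>) * (2 * of_int p ^ Suc n * C) - (of_int p)\<^sup>2 * (2 * of_int p ^ n * C')"
    unfolding rec by (simp add: algebra_simps power2_eq_square)
  also have "\<dots> = of_int (2 * x * a - p\<^sup>2 * b)"
    unfolding assms(2) using a b by (simp add: C_def C'_def)
  finally have 1: "2 * of_int p ^ Suc (Suc n) * cos (real (Suc (Suc n)) * \<theta>) =
    of_int (2 * x * a - p\<^sup>2 * b)" .
  have "2 * x * a - p\<^sup>2 * b - (2 * x) ^ Suc (Suc n) = 2 * x * (a - (2 * x) ^ Suc n) - p * (p * b)"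
    by (simp add: algebra_simps power2_eq_square)
  then have "p dvd 2 * x * a - p\<^sup>2 * b - (2 * x) ^ Suc (Suc n)"
    using c by simp
  then show ?case using 1 a by blast
qed

text \<open>If the cosine were 1, its numerator \<open>2 * p ^ n\<close> would be divisible by
  \<open>p\<close>, although it is congruent to \<open>(2 * x) ^ n\<close>.\<close>

lemma cos_multiple_neq_1:
  fixes x p :: int
  assumes p: "prime p" "\<not> p dvd 2 * x" and c: "of_int p * cos \<theta> = (of_int x :: real)" and n: "n > 0"
  shows "cos (real n * \<theta>) \<noteq> 1"
proof
  assume 1: "cos (real n * \<theta>) = 1"
  obtain m where m: "n = Suc m" using n by (cases n) auto
  obtain a where a: "2 * of_int p ^ n * cos (real n * \<theta>) = of_int a" "p dvd a - (2 * x) ^ n"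
    using cos_multiple_numerator[OF prime_gt_0_int[OF p(1)] c, of m] unfolding m by blast
  have "real_of_int a = of_int (2 * p ^ n)" using a 1 by simp
  then have "a = 2 * p ^ n" by (simp only: of_int_eq_iff)
  then have "p dvd a" using m by simp
  then have "p dvd (2 * x) ^ n" using a(2) dvd_diff_right_iff by blast
  then show False using p prime_dvd_power by blast
qed

text \<open>Exponentiating turns the relation into a multiplicative one between the numbers
  \<open>cis (\<theta> k)\<close>, whose real parts are rational and whose imaginary parts are
  \<open>2 / p * sqrt (k * (p - k))\<close>. As \<open>S\<close> never contains both
  \<open>k\<close> and \<open>p - k\<close>, the quadratic fields differ and some nontrivial power
  of \<open>z i\<close> would be 1.\<close>

lemma arccos_pi_independent:
  fixes p :: nat and l :: "nat \<Rightarrow> int" and q :: int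
  assumes p: "prime p" "odd p" and S: "S \<subseteq> {0<..<p}" "\<And>j k. j \<in> S \<Longrightarrow> k \<in> S \<Longrightarrow> j + k \<noteq> p"
    and rel: "(\<Sum>k\<in>S. of_int (l k) * arccos (1 - 2 * real k / real p)) = of_int q * pi"
    and i: "i \<in> S"
  shows "l i = 0"
proof (rule ccontr)
  assume li: "l i \<noteq> 0"
  have fin: "finite S" using S(1) finite_subset by blast
  have p0: "real p > 0" using p(1) prime_gt_0_nat by simp
  define \<theta> where "\<theta> k = arccos (1 - 2 * real k / real p)" for k
  define \<delta> where "\<delta> k = k * (p - k)" for k
  have cos\<theta>: "cos (\<theta> k) = 1 - 2 * real k / real p"
    and sin\<theta>: "sin (\<theta> k) = 2 / real p * sqrt (real (\<delta> k))" if "k \<in> S" for k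
  proof -
    have kp: "k < p" using S(1) that by auto
    then have b: "- 1 \<le> 1 - 2 * real k / real p" "1 - 2 * real k / real p \<le> 1"
      using p0 by (auto simp: field_simps)
    show "cos (\<theta> k) = 1 - 2 * real k / real p"
      unfolding \<theta>_def using b by (rule cos_arccos)
    have "1 - (1 - 2 * real k / real p)\<^sup>2 = (2 / real p)\<^sup>2 * real (\<delta> k)"
      using p0 kp by (simp add: \<delta>_def field_simps power2_eq_square of_nat_diff)
    then show "sin (\<theta> k) = 2 / real p * sqrt (real (\<delta> k))"
      unfolding \<theta>_def using b p0 by (simp add: sin_arccos real_sqrt_mult)
  qed
  define z where "z k = cis (\<theta> k)" for k
  have zp: "z k powi n = cis (of_int n * \<theta> k)" for k n
    unfolding z_def by (simp add: cis_power_int)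
  \<comment> \<open>Doubling the exponents makes the right-hand side a multiple of
    \<open>2 * pi\<close> also for odd \<open>q\<close>.\<close>
  have "(\<Prod>k\<in>S. z k powi (2 * l k)) = cis (\<Sum>k\<in>S. 2 * (of_int (l k) * \<theta> k))"
    using fin unfolding zp by (induction S rule: finite_induct) (auto simp: cis_mult algebra_simps)
  also have "(\<Sum>k\<in>S. 2 * (of_int (l k) * \<theta> k)) = 2 * pi * of_int q"
    using rel by (simp add: \<theta>_def flip: sum_distrib_left)
  also have "cis (2 * pi * of_int q) = 1" by (simp add: cis_multiple_2pi)
  finally have prod1: "(\<Prod>k\<in>S. z k powi (2 * l k)) = 1" .
  have "\<exists>n>0. z i powi (of_nat n * (2 * l i)) = 1"
  proof (rule unimodular_relation_imp_root_of_unity[where S = S and \<delta> = \<delta> and x = "\<lambda>k. cos (\<theta> k)"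
        and y = "\<lambda>k. 2 / real p" and l = "\<lambda>k. 2 * l k"])
    show "\<delta> k > 0" if "k \<in> S" for k using that S(1) by (auto simp: \<delta>_def)
    show "cos (\<theta> k) \<in> \<rat> \<and> 2 / real p \<in> \<rat> \<and> z k = complex_of_real (cos (\<theta> k)) +
        complex_of_real (2 / real p) * (\<i> * complex_of_real (sqrt (real (\<delta> k)))) \<and> cmod (z k) = 1"
      if "k \<in> S" for k
      using sin\<theta>[OF that] cos\<theta>[OF that] by (simp add: z_def complex_eq_iff)
    show "\<i> * complex_of_real (sqrt (real (\<delta> k))) \<notin>
       {a + b * (\<i> * complex_of_real (sqrt (real (\<delta> j)))) |a b. a \<in> \<rat> \<and> b \<in> \<rat>}"
      if "j \<in> S" "k \<in> S" "j \<noteq> k" for j k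
    proof (rule imaginary_quadratic_notin)
      have jk: "0 < j" "j < p" "0 < k" "k < p" using that S(1) by auto
      fix s :: int
      have "s\<^sup>2 \<noteq> (int j * (int p - int j)) * (int k * (int p - int k))"
        by (rule product_of_norms_not_square) (use p jk that S(2)[OF that(1,2)] in auto)
      then show "s\<^sup>2 \<noteq> int (\<delta> j) * int (\<delta> k)" using jk by (simp add: \<delta>_def of_nat_diff)
    qed
  qed (use fin prod1 i in auto)
  then obtain n where n: "n > 0" "z i powi (of_nat n * (2 * l i)) = 1" by blast
  \<comment> \<open>The exponent may be negative; since the cosine is even, its absolute value
    serves as well.\<close>
  define N where "N = nat \<bar>int n * (2 * l i)\<bar>"
  have "cos (of_int (int n * (2 * l i)) * \<theta> i) = 1"
    using n(2) unfolding zp by (simp add: complex_eq_iff)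
  then have "cos (real N * \<theta> i) = 1"
    unfolding N_def by (cases "int n * (2 * l i) \<ge> 0") (auto simp: abs_if split: if_splits)
  moreover have "cos (real N * \<theta> i) \<noteq> 1"
  proof (rule cos_multiple_neq_1)
    have ip: "0 < i" "i < p" using i S(1) by auto
    show "prime (int p)" using p by simp
    show "of_int (int p) * cos (\<theta> i) = of_int (int p - 2 * int i)"
      using cos\<theta>[OF i] p0 by (simp add: field_simps)
    show "N > 0" using n(1) li by (simp add: N_def)
    show "\<not> int p dvd 2 * (int p - 2 * int i)"
    proof
      assume "int p dvd 2 * (int p - 2 * int i)"
      then have "int p dvd 2 * int p - 2 * (int p - 2 * int i)" by (intro dvd_diff) auto
      then have "int p dvd int (2 * (2 * i))" by simp
      then have "p dvd 2 * (2 * i)" by (simp only: int_dvd_int_iff)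
      then have "p dvd 2 \<or> p dvd i" using p(1) by (simp only: prime_dvd_mult_iff) blast
      then show False using p ip nat_dvd_not_less primes_dvd_imp_eq two_is_prime_nat by (metis even_numeral dvd_refl)
    qed
  qed
  ultimately show False by simp
qed

section \<open>Simultaneous approximation by Kronecker's theorem\<close>

lemma Kronecker_approx_family:
  fixes \<theta> \<alpha> :: "'k \<Rightarrow> real"
  assumes fin: "finite S" and "\<epsilon> > 0"
    and indep: "\<And>l q k. (\<Sum>k\<in>S. of_int (l k) * \<theta> k) = of_int q \<Longrightarrow> k \<in> S \<Longrightarrow> l k = (0::int)"
  shows "\<exists>(t::int) h. \<forall>k\<in>S. \<bar>of_int t * \<theta> k - of_int (h k) - \<alpha> k\<bar> < \<epsilon>"
proof -
  interpret Modules.module "\<lambda>r. (*) (real_of_int r)"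
    by (simp add: Modules.module.intro distrib_left mult.commute)
  define n where "n = card S"
  obtain e where e: "bij_betw e {..<n} S"
    using ex_bij_betw_nat_finite[OF fin] by (auto simp: n_def atLeast0LessThan)
  \<comment> \<open>Independence of the family modulo integers is linear independence over the
    integers together with the number 1, which \<open>f\<close> places at the last index
    \<open>n\<close>.\<close>
  define f where "f i = (if i < n then \<theta> (e i) else 1)" for i
  have eS: "e i \<in> S" if "i < n" for i using e that by (auto simp: bij_betw_def)
  have single: "(\<Sum>k\<in>S. of_int (if k = e i then c else 0) * \<theta> k) = of_int c * f i" if "i < n" for i c
  proof -
    have "(\<Sum>k\<in>S. of_int (if k = e i then c else 0) * \<theta> k) = (\<Sum>k\<in>S. if k = e i then of_int c * \<theta> k else 0)"
      by (intro sum.cong) auto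
    then show ?thesis using fin eS[OF that] that by (simp add: f_def)
  qed
  have f1: "f i \<noteq> 1" if "i < n" for i
  proof
    assume "f i = 1"
    then have "(\<Sum>k\<in>S. of_int (if k = e i then 1 else 0) * \<theta> k) = of_int 1"
      using single[OF that, of 1] by simp
    from indep[OF this eS[OF that]] show False by simp
  qed
  have f2: "i = j" if "i < n" "j < n" "f i = f j" for i j
  proof (rule ccontr)
    assume "i \<noteq> j"
    then have ne: "e i \<noteq> e j" using e that by (auto simp: bij_betw_def inj_on_def)
    have "(\<Sum>k\<in>S. of_int ((if k = e i then 1 else 0) + (if k = e j then - 1 else 0)) * \<theta> k) = of_int 0"
      using single[OF that(1), of 1] single[OF that(2), of "- 1"] that(3)
      by (simp only: of_int_add distrib_right sum.distrib)
    from indep[OF this eS[OF that(1)]] show False using ne by simp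
  qed
  \<comment> \<open>Linear independence concerns the set of values, so repetitions must be excluded.
    They would be relations \<open>\<theta> k = 1\<close> or
    \<open>\<theta> k - \<theta> k' = 0\<close>, ruled out by \<open>indep\<close>.\<close>
  have inj: "inj_on f {..n}"
  proof (rule inj_onI)
    fix i j assume "i \<in> {..n}" "j \<in> {..n}" "f i = f j"
    moreover have "f n = 1" by (simp add: f_def)
    ultimately show "i = j" using f1 f2 by (metis atMost_iff le_neq_implies_less)
  qed
  have "module.independent (\<lambda>r x. of_int r * x) (f ` {..n})"
  proof (subst dependent_finite, simp, safe)
    fix u i assume i: "i \<le> n" and u: "u (f i) \<noteq> (0::int)"
      and sum0: "(\<Sum>v\<in>f ` {..n}. of_int (u v) * v) = 0"
    have "(\<Sum>v\<in>f ` {..n}. of_int (u v) * v) = (\<Sum>i\<le>n. of_int (u (f i)) * f i)"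
      by (simp add: sum.reindex[OF inj])
    also have "\<dots> = (\<Sum>i<n. of_int (u (f i)) * f i) + of_int (u 1)"
      by (simp add: f_def lessThan_Suc_atMost[symmetric])
    also have "(\<Sum>i<n. of_int (u (f i)) * f i) = (\<Sum>i<n. of_int (u (\<theta> (e i))) * \<theta> (e i))"
      by (intro sum.cong) (auto simp: f_def)
    also have "\<dots> = (\<Sum>k\<in>S. of_int (u (\<theta> k)) * \<theta> k)"
      by (rule sum.reindex_bij_betw[OF e])
    finally have rel: "(\<Sum>k\<in>S. of_int (u (\<theta> k)) * \<theta> k) = of_int (- u 1)" using sum0 by simp
    have 0: "u (\<theta> k) = 0" if "k \<in> S" for k using indep[OF rel that] .
    moreover from 0 rel have "u 1 = 0" by simp
    ultimately show False using u i eS by (auto simp: f_def split: if_splits)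
  qed
  from Kronecker_thm_2[OF this inj _ \<open>\<epsilon> > 0\<close>, of "\<alpha> \<circ> e"]
  obtain t m where tm: "\<And>i. i < n \<Longrightarrow> \<bar>of_int t * f i - of_int (m i) - (\<alpha> \<circ> e) i\<bar> < \<epsilon>"
    by (auto simp: f_def)
  show ?thesis
  proof (intro exI ballI)
    fix k assume k: "k \<in> S"
    define i where "i = the_inv_into {..<n} e k"
    have "i < n" "e i = k"
      using e k f_the_inv_into_f_bij_betw[OF e] the_inv_into_into[of e "{..<n}" k "{..<n}"]
      by (auto simp: i_def bij_betw_def)
    then show "\<bar>of_int t * \<theta> k - of_int ((m \<circ> the_inv_into {..<n} e) k) - \<alpha> k\<bar> < \<epsilon>"
      using tm[of i] by (simp add: f_def i_def)
  qed
qed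

lemma abs_cos_diff_le: "\<bar>cos x - cos y\<bar> \<le> \<bar>x - y :: real\<bar>"
proof -
  have "\<bar>cos x - cos y\<bar> = 2 * \<bar>sin ((x + y) / 2)\<bar> * \<bar>sin ((y - x) / 2)\<bar>"
    by (simp add: cos_diff_cos abs_mult)
  also have "\<dots> \<le> 2 * 1 * \<bar>(y - x) / 2\<bar>"
    by (intro mult_mono abs_sin_le_one abs_sin_x_le_abs_x) auto
  finally show ?thesis by simp
qed

text \<open>Kronecker's theorem is applied to \<open>\<theta> k / pi\<close> with targets
  \<open>(\<tau> k - r * \<theta> k) / (2 * pi)\<close>. Then \<open>2 * s + r\<close> has the
  parity of \<open>r\<close>, and its product with \<open>\<theta> k\<close> is close to
  \<open>\<tau> k\<close> modulo \<open>2 * pi\<close>.\<close>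

lemma simultaneous_cos_approx:
  fixes p r :: nat and \<tau> :: "nat \<Rightarrow> real"
  assumes p: "prime p" "odd p" and S: "S \<subseteq> {0<..<p}" "\<And>j k. j \<in> S \<Longrightarrow> k \<in> S \<Longrightarrow> j + k \<noteq> p"
    and "(\<epsilon>::real) > 0"
  shows "\<exists>t::nat. even t = even r \<and>
    (\<forall>k\<in>S. \<bar>cos (real t * arccos (1 - 2 * real k / real p)) - cos (\<tau> k)\<bar> < \<epsilon>)"
proof -
  define \<theta> where "\<theta> k = arccos (1 - 2 * real k / real p)" for k
  have fin: "finite S" using S(1) finite_subset by blast
  have "\<exists>(s::int) h. \<forall>k\<in>S. \<bar>of_int s * (\<theta> k / pi) - of_int (h k) - (\<tau> k - real r * \<theta> k) / (2 * pi)\<bar> < \<epsilon> / (2 * pi)"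
  proof (rule Kronecker_approx_family[OF fin])
    show "\<epsilon> / (2 * pi) > 0" using \<open>\<epsilon> > 0\<close> by simp
    fix l q i assume "(\<Sum>k\<in>S. of_int (l k) * (\<theta> k / pi)) = of_int q" and i: "i \<in> S"
    then have "(\<Sum>k\<in>S. of_int (l k) * \<theta> k) = of_int q * pi"
      by (simp add: field_simps flip: sum_divide_distrib)
    then show "l i = 0"
      using arccos_pi_independent[OF p S _ i] by (simp add: \<theta>_def)
  qed
  then obtain s h where sh: "\<And>k. k \<in> S \<Longrightarrow>
      \<bar>of_int s * (\<theta> k / pi) - of_int (h k) - (\<tau> k - real r * \<theta> k) / (2 * pi)\<bar> < \<epsilon> / (2 * pi)"
    by blast
  define t0 where "t0 = 2 * s + int r"
  \<comment> \<open>Neither the cosine nor the parity changes with the sign of \<open>t0\<close>, so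
    a natural time suffices.\<close>
  define t where "t = nat \<bar>t0\<bar>"
  have "\<bar>cos (real t * \<theta> k) - cos (\<tau> k)\<bar> < \<epsilon>" if "k \<in> S" for k
  proof -
    have "cos (real t * \<theta> k) = cos (of_int t0 * \<theta> k)"
      by (cases "t0 \<ge> 0") (simp_all add: t_def abs_if)
    moreover have "cos (\<tau> k) = cos (\<tau> k + of_int (h k) * (2 * pi))"
      using cos_int_2pin[of "h k"] sin_int_2pin[of "h k"] by (simp add: cos_add mult.commute)
    ultimately have "\<bar>cos (real t * \<theta> k) - cos (\<tau> k)\<bar> \<le>
        \<bar>of_int t0 * \<theta> k - (\<tau> k + of_int (h k) * (2 * pi))\<bar>"
      using abs_cos_diff_le by metis
    also have "of_int t0 * \<theta> k - (\<tau> k + of_int (h k) * (2 * pi)) =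
        2 * pi * (of_int s * (\<theta> k / pi) - of_int (h k) - (\<tau> k - real r * \<theta> k) / (2 * pi))"
      by (simp add: t0_def field_simps)
    also have "\<bar>\<dots>\<bar> < 2 * pi * (\<epsilon> / (2 * pi))"
      using sh[OF that] unfolding abs_mult abs_numeral abs_of_pos[OF pi_gt_zero]
      by (intro mult_strict_left_mono) auto
    finally show ?thesis by simp
  qed
  moreover have "even t = even r" by (simp add: t_def t0_def even_nat_iff)
  ultimately show ?thesis unfolding \<theta>_def by blast
qed

section \<open>Walks given by an orthonormal incidence matrix\<close>

text \<open>
  In matrix terms \<open>down\<close> is \<open>N\<close>, \<open>up\<close> is \<open>N\<^sup>*\<close>, and \<open>step\<close> is \<open>R (2 N\<^sup>* N - I)\<close>, where \<open>rev\<close> gives the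
  permutation matrix \<open>R\<close>.
\<close>

locale coined_walk =
  fixes V :: "'v set" and A :: "'a set" and N :: "('v, 'a) cmatrix" and rev :: "'a \<Rightarrow> 'a"
  assumes finite_V: "finite V" and finite_A: "finite A"
    and rev_in: "p \<in> A \<Longrightarrow> rev p \<in> A" and rev_rev: "p \<in> A \<Longrightarrow> rev (rev p) = p"
    and orthonormal: "u \<in> V \<Longrightarrow> v \<in> V \<Longrightarrow> (\<Sum>q\<in>A. N u q * cnj (N v q)) = id_mat u v"
begin

definition down :: "'a cvector \<Rightarrow> 'v cvector" where
  "down x u = (\<Sum>q\<in>A. N u q * x q)"

definition up :: "'v cvector \<Rightarrow> 'a cvector" where
  "up f q = (\<Sum>u\<in>V. cnj (N u q) * f u)"

definition step :: "'a cvector \<Rightarrow> 'a cvector" where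
  "step x p = 2 * up (down x) (rev p) - x (rev p)"

lemma down_up: "u \<in> V \<Longrightarrow> down (up f) u = f u"
proof -
  assume u: "u \<in> V"
  have "down (up f) u = (\<Sum>v\<in>V. f v * (\<Sum>q\<in>A. N u q * cnj (N v q)))"
    unfolding down_def up_def sum_distrib_left by (subst sum.swap) (simp add: algebra_simps)
  also have "\<dots> = (\<Sum>v\<in>V. if u = v then f v else 0)"
    using u by (intro sum.cong) (auto simp: orthonormal id_mat_def)
  finally show ?thesis using u finite_V by simp
qed

lemma inner_up: "(\<Sum>p\<in>A. x p * cnj (up f p)) = (\<Sum>u\<in>V. down x u * cnj (f u))"
  unfolding down_def up_def cnj_sum sum_distrib_left sum_distrib_right
  by (subst sum.swap) (simp add: algebra_simps)

lemma down_cong: "(\<And>p. p \<in> A \<Longrightarrow> x p = y p) \<Longrightarrow> down x = down y"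
  unfolding down_def by (intro ext sum.cong) auto

lemma up_cong: "(\<And>u. u \<in> V \<Longrightarrow> f u = g u) \<Longrightarrow> up f = up g"
  unfolding up_def by (intro ext sum.cong) auto

lemma step_cong: "(\<And>p. p \<in> A \<Longrightarrow> x p = y p) \<Longrightarrow> p \<in> A \<Longrightarrow> step x p = step y p"
  unfolding step_def using down_cong[of x y] rev_in by simp

lemma sum_rev: "(\<Sum>p\<in>A. g (rev p)) = (\<Sum>p\<in>A. g p)"
  by (rule sum.reindex_bij_witness[of _ rev rev]) (auto simp: rev_in rev_rev)

text \<open>As \<open>N N* = I\<close>, the product \<open>N* N\<close> is an orthogonal projection,
  so \<open>2 N* N - I\<close> is a reflection; \<open>rev\<close> only permutes the arcs.\<close>

lemma sum_norm_step: "(\<Sum>p\<in>A. (cmod (step x p))\<^sup>2) = (\<Sum>p\<in>A. (cmod (x p))\<^sup>2)"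
proof -
  define y where "y = up (down x)"
  \<comment> \<open>This is the squared norm of \<open>N x\<close>, the common value of the inner
    products of \<open>x\<close> with \<open>y\<close>, \<open>y\<close> with \<open>x\<close> and
    \<open>y\<close> with \<open>y\<close>; in the expansion \<open>4 * g - 2 * g - 2 * g\<close>
    cancels.\<close>
  define g where "g = (\<Sum>u\<in>V. down x u * cnj (down x u))"
  have xy: "(\<Sum>p\<in>A. x p * cnj (y p)) = g"
    unfolding y_def g_def by (rule inner_up)
  have "cnj g = g" by (simp add: g_def mult.commute)
  then have yx: "(\<Sum>p\<in>A. y p * cnj (x p)) = g"
    using arg_cong[OF xy, of cnj] by (simp add: mult.commute)
  have yy: "(\<Sum>p\<in>A. y p * cnj (y p)) = g"
    unfolding y_def g_def inner_up by (intro sum.cong) (auto simp: down_up)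
  have "complex_of_real (\<Sum>p\<in>A. (cmod (2 * y p - x p))\<^sup>2) = (\<Sum>p\<in>A. (2 * y p - x p) * cnj (2 * y p - x p))"
    by (simp only: of_real_sum complex_norm_square)
  also have "\<dots> = (\<Sum>p\<in>A. 4 * (y p * cnj (y p)) - 2 * (y p * cnj (x p)) - 2 * (x p * cnj (y p)) + x p * cnj (x p))"
    by (intro sum.cong) (auto simp: algebra_simps)
  also have "\<dots> = 4 * g - 2 * g - 2 * g + (\<Sum>p\<in>A. x p * cnj (x p))"
    unfolding sum.distrib sum_subtractf sum_distrib_left[symmetric] yy yx xy by simp
  also have "\<dots> = complex_of_real (\<Sum>p\<in>A. (cmod (x p))\<^sup>2)"
    by (simp only: of_real_sum complex_norm_square) simp
  finally have "(\<Sum>p\<in>A. (cmod (2 * y p - x p))\<^sup>2) = (\<Sum>p\<in>A. (cmod (x p))\<^sup>2)"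
    by (simp only: of_real_eq_iff)
  moreover have "(\<Sum>p\<in>A. (cmod (step x p))\<^sup>2) = (\<Sum>p\<in>A. (cmod (2 * y p - x p))\<^sup>2)"
    unfolding step_def y_def[symmetric] by (rule sum_rev)
  ultimately show ?thesis by simp
qed

lemma sum_norm_step_pow: "(\<Sum>p\<in>A. (cmod ((step ^^ t) x p))\<^sup>2) = (\<Sum>p\<in>A. (cmod (x p))\<^sup>2)"
  by (induction t) (simp_all add: sum_norm_step)

lemma down_linear: "down (\<lambda>p. a * x p - y p) u = a * down x u - down y u"
  unfolding down_def by (simp add: algebra_simps sum_subtractf sum_distrib_left)

lemma up_linear: "up (\<lambda>u. a * f u - g u) p = a * up f p - up g p"
  unfolding up_def by (simp add: algebra_simps sum_subtractf sum_distrib_left)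

lemma step_linear: "step (\<lambda>p. a * x p - y p) = (\<lambda>p. a * step x p - step y p)"
proof
  fix p
  have "down (\<lambda>p. a * x p - y p) = (\<lambda>u. a * down x u - down y u)" by (rule ext) (rule down_linear)
  then show "step (\<lambda>p. a * x p - y p) p = a * step x p - step y p"
    unfolding step_def by (simp add: up_linear algebra_simps)
qed

lemma down_sum: "down (\<lambda>p. \<Sum>i\<in>I. x i p) u = (\<Sum>i\<in>I. down (x i) u)"
  unfolding down_def sum_distrib_left by (rule sum.swap)

lemma up_sum: "up (\<lambda>u. \<Sum>i\<in>I. f i u) p = (\<Sum>i\<in>I. up (f i) p)"
  unfolding up_def sum_distrib_left by (rule sum.swap)

lemma step_sum: "step (\<lambda>p. \<Sum>i\<in>I. x i p) = (\<lambda>p. \<Sum>i\<in>I. step (x i) p)"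
proof
  fix p
  have "down (\<lambda>p. \<Sum>i\<in>I. x i p) = (\<lambda>u. \<Sum>i\<in>I. down (x i) u)" by (rule ext) (rule down_sum)
  then show "step (\<lambda>p. \<Sum>i\<in>I. x i p) p = (\<Sum>i\<in>I. step (x i) p)"
    unfolding step_def by (simp add: up_sum sum_subtractf sum_distrib_left)
qed

lemma step_pow_sum: "(step ^^ t) (\<lambda>p. \<Sum>i\<in>I. x i p) = (\<lambda>p. \<Sum>i\<in>I. (step ^^ t) (x i) p)"
  by (induction t) (simp_all add: step_sum)

text \<open>On the orbit of \<open>up f\<close> the walk obeys the three-term recurrence of
  \<open>cos (t * \<theta>)\<close>, and \<open>down\<close> carries it over to the coefficient of
  \<open>f\<close>.\<close>

lemma down_step_pow_eigenvector:
  assumes eig: "\<And>u. u \<in> V \<Longrightarrow> down (\<lambda>p. up f (rev p)) u = complex_of_real (cos \<theta>) * f u" and u: "u \<in> V"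
  shows "down ((step ^^ t) (up f)) u = complex_of_real (cos (real t * \<theta>)) * f u"
proof -
  define v where "v t = (step ^^ t) (up f)" for t
  define c where "c = complex_of_real (cos \<theta>)"
  have v1: "v (Suc 0) p = up f (rev p)" for p
    using up_cong[of "down (up f)" f] down_up by (simp add: v_def step_def)
  \<comment> \<open>The eigenvalue enters only for \<open>t = 0\<close>; applying the linear map
    \<open>step\<close> gives all later instances.\<close>
  have rec: "v (Suc (Suc t)) p = 2 * c * v (Suc t) p - v t p" if "p \<in> A" for t p
    using that
  proof (induction t arbitrary: p)
    case 0
    have dv1: "down (v (Suc 0)) = down (\<lambda>p. up f (rev p))" by (rule down_cong) (simp add: v1)
    have "up (down (v (Suc 0))) = up (\<lambda>u. c * f u - 0)"
      unfolding dv1 by (rule up_cong) (simp add: eig c_def)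
    then have "up (down (v (Suc 0))) (rev p) = c * up f (rev p)"
      using up_linear[of c f "\<lambda>_. 0" "rev p"] by (simp add: up_def)
    then have "step (v (Suc 0)) p = 2 * (c * up f (rev p)) - up f (rev (rev p))"
      unfolding step_def v1 by simp
    moreover have "v (Suc (Suc 0)) = step (v (Suc 0))" by (simp add: v_def)
    ultimately show ?case
      using 0 by (simp add: rev_rev v1) (simp add: v_def)
  next
    case (Suc t)
    have "v (Suc (Suc (Suc t))) p = step (v (Suc (Suc t))) p" by (simp add: v_def)
    also have "\<dots> = step (\<lambda>p. 2 * c * v (Suc t) p - v t p) p"
      by (rule step_cong) (use Suc in auto)
    also have "\<dots> = 2 * c * v (Suc (Suc t)) p - v (Suc t) p"
      unfolding step_linear by (simp add: v_def)
    finally show ?case .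
  qed
  have "down (v t) u = complex_of_real (cos (real t * \<theta>)) * f u \<and>
        down (v (Suc t)) u = complex_of_real (cos (real (Suc t) * \<theta>)) * f u"
  proof (induction t)
    case 0
    have "down (v (Suc 0)) = down (\<lambda>p. up f (rev p))" by (rule down_cong) (simp add: v1)
    then show ?case using eig[OF u] down_up[OF u] by (simp add: v_def)
  next
    case (Suc t)
    have "down (v (Suc (Suc t))) = down (\<lambda>p. 2 * c * v (Suc t) p - v t p)"
      by (rule down_cong) (rule rec)
    then have "down (v (Suc (Suc t))) u = 2 * c * down (v (Suc t)) u - down (v t) u"
      by (simp add: down_linear)
    also have "\<dots> = complex_of_real (2 * cos \<theta> * cos (real (Suc t) * \<theta>) - cos (real t * \<theta>)) * f u"
      using Suc by (simp add: c_def algebra_simps)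
    also have "2 * cos \<theta> * cos (real (Suc t) * \<theta>) - cos (real t * \<theta>) = cos (real (Suc (Suc t)) * \<theta>)"
      using cos_times_cos[of \<theta> "real (Suc t) * \<theta>"] by (simp add: algebra_simps cos_add cos_diff)
    finally show ?case using Suc by blast
  qed
  then show ?thesis unfolding v_def by blast
qed

text \<open>Both states are unit vectors and the walk preserves norms, so the squared distance is 2
  minus twice the real part of the inner product. By adjointness this inner product is
  \<open>down\<close> of the evolved state at \<open>b\<close>, which the eigenvector expansion of
  \<open>std_basis a\<close> evaluates.\<close>

lemma transfer_error:
  assumes b: "b \<in> V" and a: "a \<in> V"
    and eig: "\<And>i u. i \<in> I \<Longrightarrow> u \<in> V \<Longrightarrow>
      down (\<lambda>p. up (f i) (rev p)) u = complex_of_real (cos (\<theta> i)) * f i u"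
    and decomp: "\<And>u. u \<in> V \<Longrightarrow> (\<Sum>i\<in>I. f i u) = std_basis a u"
  shows "(\<Sum>p\<in>A. (cmod ((step ^^ t) (up (std_basis a)) p - up (std_basis b) p))\<^sup>2) =
    2 - 2 * Re (\<Sum>i\<in>I. complex_of_real (cos (real t * \<theta> i)) * f i b)"
proof -
  have pick: "(\<Sum>u\<in>V. g u * cnj (std_basis c u)) = g c" if "c \<in> V" for c g
  proof -
    have "(\<Sum>u\<in>V. g u * cnj (std_basis c u)) = (\<Sum>u\<in>V. if u = c then g u else 0)"
      by (intro sum.cong) (auto simp: std_basis_def)
    then show ?thesis using that finite_V by simp
  qed
  have unit: "(\<Sum>p\<in>A. (cmod (up (std_basis c) p))\<^sup>2) = 1" if "c \<in> V" for c
  proof -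
    have "complex_of_real (\<Sum>p\<in>A. (cmod (up (std_basis c) p))\<^sup>2) = (\<Sum>p\<in>A. up (std_basis c) p * cnj (up (std_basis c) p))"
      by (simp only: of_real_sum complex_norm_square)
    also have "\<dots> = 1" unfolding inner_up pick[OF that] down_up[OF that] by (simp add: std_basis_def)
    finally show ?thesis by (simp only: of_real_eq_1_iff)
  qed
  define X where "X = (step ^^ t) (up (std_basis a))"
  define Y where "Y = up (std_basis b)"
  have "up (std_basis a) = up (\<lambda>u. \<Sum>i\<in>I. f i u)"
    by (rule up_cong) (simp add: decomp)
  then have "up (std_basis a) = (\<lambda>p. \<Sum>i\<in>I. up (f i) p)" by (simp add: up_sum fun_eq_iff)
  then have Xb: "down X b = (\<Sum>i\<in>I. complex_of_real (cos (real t * \<theta> i)) * f i b)"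
    unfolding X_def by (simp add: step_pow_sum down_sum down_step_pow_eigenvector[OF eig b])
  have XY: "(\<Sum>p\<in>A. X p * cnj (Y p)) = down X b"
    unfolding Y_def inner_up pick[OF b] ..
  have "(cmod (X p - Y p))\<^sup>2 = (cmod (X p))\<^sup>2 + (cmod (Y p))\<^sup>2 - 2 * Re (X p * cnj (Y p))" for p
    unfolding cmod_power2 by (simp add: power2_eq_square algebra_simps)
  then have "(\<Sum>p\<in>A. (cmod (X p - Y p))\<^sup>2) =
      (\<Sum>p\<in>A. (cmod (X p))\<^sup>2) + (\<Sum>p\<in>A. (cmod (Y p))\<^sup>2) - 2 * Re (\<Sum>p\<in>A. X p * cnj (Y p))"
    by (simp only: sum.distrib sum_subtractf Re_sum sum_distrib_left)
  also have "\<dots> = 2 - 2 * Re (down X b)"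
    unfolding XY using unit[OF a] unit[OF b] by (simp add: X_def Y_def sum_norm_step_pow)
  finally show ?thesis unfolding Xb unfolding X_def Y_def .
qed

end

section \<open>The weighted hypercube\<close>

text \<open>Passes from matrix powers to iterates of an operator. Entries outside \<open>I\<close>
  are arbitrary, so \<open>U\<close> is compared with \<open>F\<close> on \<open>I\<close> only, and
  \<open>cong\<close> says that \<open>F\<close> looks only there.\<close>

lemma mat_vec_mat_power:
  assumes U: "\<And>x p. p \<in> I \<Longrightarrow> mat_vec I U x p = F x p"
    and cong: "\<And>x y p. (\<And>q. q \<in> I \<Longrightarrow> x q = y q) \<Longrightarrow> p \<in> I \<Longrightarrow> F x p = F y p"
    and fin: "finite I" and p: "p \<in> I"
  shows "mat_vec I (mat_power I U t) x p = (F ^^ t) x p"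
  using p
proof (induction t arbitrary: p)
  case 0
  have "mat_vec I id_mat x p = (\<Sum>j\<in>I. if p = j then x j else 0)"
    unfolding mat_vec_def id_mat_def by (intro sum.cong) auto
  then show ?case using 0 fin by simp
next
  case (Suc t)
  have "mat_vec I (mat_power I U (Suc t)) x p = mat_vec I U (mat_vec I (mat_power I U t) x) p"
    unfolding mat_vec_def mat_power.simps mat_mult_def sum_distrib_left sum_distrib_right
    by (subst sum.swap) (simp add: mult.assoc)
  also have "\<dots> = F ((F ^^ t) x) p"
    unfolding U[OF Suc.prems] by (rule cong) (use Suc in auto)
  finally show ?case by simp
qed

definition cube_flip :: "(nat \<Rightarrow> bit) \<Rightarrow> nat \<Rightarrow> nat \<Rightarrow> bit" where
  "cube_flip u j = u(j := u j + 1)"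

lemma cube_flip_flip [simp]: "cube_flip (cube_flip u j) j = u"
  by (cases "u j") (auto simp: cube_flip_def)

lemma cube_flip_in [simp]: "j < d \<Longrightarrow> u \<in> cube_verts d \<Longrightarrow> cube_flip u j \<in> cube_verts d"
  by (auto simp: cube_flip_def cube_verts_def)

lemma std_basis_eq_iff [simp]: "std_basis i = (std_basis j :: nat \<Rightarrow> bit) \<longleftrightarrow> i = j"
  by (metis std_basis_def zero_neq_one)

lemma diff_eq_std_basis_iff: "u - v = std_basis j \<longleftrightarrow> v = cube_flip u j"
proof
  assume h: "u - v = std_basis j"
  show "v = cube_flip u j"
  proof
    fix i
    show "v i = cube_flip u j i"
      using fun_cong[OF h, of i] by (cases "u i"; cases "v i") (auto simp: cube_flip_def std_basis_def split: if_splits)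
  qed
next
  assume "v = cube_flip u j"
  then show "u - v = std_basis j"
    by (cases "u j") (auto simp: cube_flip_def std_basis_def fun_eq_iff)
qed

lemma cube_flip_inject [simp]: "cube_flip u i = cube_flip u j \<longleftrightarrow> i = j"
  by (metis diff_eq_std_basis_iff std_basis_eq_iff)

lemma cube_edge_iff:
  "{u, v} \<in> cube_edges d \<longleftrightarrow> u \<in> cube_verts d \<and> (\<exists>j<d. v = cube_flip u j)"
proof
  assume h: "{u, v} \<in> cube_edges d"
  then have "u \<in> cube_verts d" "v \<in> cube_verts d"
    by (auto simp: cube_edges_def doubleton_eq_iff)
  then show "u \<in> cube_verts d \<and> (\<exists>j<d. v = cube_flip u j)"
    using h by (simp add: cube_edges_iff diff_eq_std_basis_iff)
next
  assume "u \<in> cube_verts d \<and> (\<exists>j<d. v = cube_flip u j)"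
  then show "{u, v} \<in> cube_edges d"
    by (auto simp: cube_edges_iff diff_eq_std_basis_iff)
qed

text \<open>An arc is determined by its tail and the coordinate in which its head differs.\<close>

lemma sum_arcs_cube:
  "(\<Sum>q\<in>arcs (cube_edges d). G q) = (\<Sum>u\<in>cube_verts d. \<Sum>j<d. G (u, cube_flip u j))"
proof -
  have "bij_betw (\<lambda>(u, j). (u, cube_flip u j)) (cube_verts d \<times> {..<d}) (arcs (cube_edges d))"
    unfolding bij_betw_def by (auto simp: inj_on_def arcs_def cube_edge_iff image_iff)
  from sum.reindex_bij_betw[OF this, of G] show ?thesis
    by (simp add: sum.cartesian_product case_prod_unfold)
qed

section \<open>Incidence matrix and walk of the weighted cube\<close>

locale weighted_cube =
  fixes d m :: nat
  assumes d: "d \<ge> 1" and m: "m \<ge> 1"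
begin

text \<open>These are the squares of the entries of the weight matrix by direction; their sum is
  each diagonal entry of \<open>W W*\<close>.\<close>

definition dir_weight :: "nat \<Rightarrow> real" where
  "dir_weight j = (if j = 0 then real m else 2)"

definition total_weight :: real where
  "total_weight = (\<Sum>j<d. dir_weight j)"

lemma dir_weight_pos: "dir_weight j > 0"
  using m by (simp add: dir_weight_def)

lemma total_weight_pos: "total_weight > 0"
  unfolding total_weight_def using d dir_weight_pos by (intro sum_pos) (auto simp: lessThan_empty_iff)

lemma total_weight_eq: "total_weight = real (2 * d - 2 + m)"
proof -
  have "{..<d} = insert 0 {1..<d}" using d by auto
  then have "total_weight = real m + (\<Sum>j\<in>{1..<d}. dir_weight j)"
    unfolding total_weight_def by (simp add: dir_weight_def)
  also have "(\<Sum>j\<in>{1..<d}. dir_weight j) = (\<Sum>j\<in>{1..<d}. 2)"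
    by (intro sum.cong) (auto simp: dir_weight_def)
  finally show ?thesis using d by (simp add: of_nat_diff)
qed

lemma cube_weight_flip: "j < d \<Longrightarrow> cube_weight d m u (cube_flip u j) = complex_of_real (sqrt (dir_weight j))"
  using d by (auto simp: cube_weight_def diff_eq_std_basis_iff dir_weight_def)

lemma cube_weight_norm:
  assumes u: "u \<in> cube_verts d"
  shows "mat_mult (cube_verts d) (cube_weight d m) (conj_transpose (cube_weight d m)) u u = complex_of_real total_weight"
proof -
  let ?W = "cube_weight d m"
  have "mat_mult (cube_verts d) ?W (conj_transpose ?W) u u = (\<Sum>v\<in>cube_flip u ` {..<d}. ?W u v * cnj (?W u v))"
    unfolding mat_mult_def conj_transpose_def
  proof (rule sum.mono_neutral_right)
    show "\<forall>v\<in>cube_verts d - cube_flip u ` {..<d}. ?W u v * cnj (?W u v) = 0"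
      using d by (auto simp: cube_weight_def diff_eq_std_basis_iff)
  qed (use finite_cube_verts u in auto)
  also have "\<dots> = (\<Sum>j<d. ?W u (cube_flip u j) * cnj (?W u (cube_flip u j)))"
    by (subst sum.reindex) (auto simp: inj_on_def)
  also have "\<dots> = (\<Sum>j<d. complex_of_real (dir_weight j))"
  proof (intro sum.cong refl)
    fix j assume "j \<in> {..<d}"
    then show "?W u (cube_flip u j) * cnj (?W u (cube_flip u j)) = complex_of_real (dir_weight j)"
      using less_imp_le[OF dir_weight_pos[of j]] by (simp add: cube_weight_flip flip: of_real_mult)
  qed
  finally show ?thesis by (simp add: total_weight_def)
qed

definition dir_coeff :: "nat \<Rightarrow> real" where
  "dir_coeff j = sqrt (dir_weight j) / sqrt total_weight"

lemma tail_incidence_cube: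
  assumes "v \<in> cube_verts d" "j < d"
  shows "tail_incidence (cube_verts d) (cube_weight d m) u (v, cube_flip v j) =
    (if u = v then complex_of_real (dir_coeff j) else 0)"
  using assms cube_weight_flip[OF assms(2), of v] cube_weight_norm[OF assms(1)]
    of_real_sqrt[OF less_imp_le[OF total_weight_pos]]
  by (simp add: tail_incidence_def dir_coeff_def)

lemma dir_coeff_square: "dir_coeff j * dir_coeff j = dir_weight j / total_weight"
  using less_imp_le[OF dir_weight_pos[of j]] less_imp_le[OF total_weight_pos] by (simp add: dir_coeff_def)

interpretation cw: coined_walk "cube_verts d" "arcs (cube_edges d)"
  "tail_incidence (cube_verts d) (cube_weight d m)" prod.swap
proof
  let ?V = "cube_verts d" and ?A = "arcs (cube_edges d)"
  let ?N = "tail_incidence ?V (cube_weight d m)"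
  show "finite ?V" by (rule finite_cube_verts)
  have "?A \<subseteq> ?V \<times> ?V" by (auto simp: arcs_def cube_edge_iff)
  then show "finite ?A" using finite_cube_verts finite_subset by blast
  show "prod.swap p \<in> ?A" if "p \<in> ?A" for p
    using that by (auto simp: arcs_def insert_commute)
  fix u v assume uv: "u \<in> ?V" "v \<in> ?V"
  have "(\<Sum>q\<in>?A. ?N u q * cnj (?N v q)) = (\<Sum>w\<in>?V. \<Sum>j<d. ?N u (w, cube_flip w j) * cnj (?N v (w, cube_flip w j)))"
    by (rule sum_arcs_cube)
  \<comment> \<open>Rows of distinct vertices live on arcs with distinct tails, so only the tail
    \<open>u\<close> contributes, and only if \<open>u = v\<close>.\<close>
  also have "\<dots> = (\<Sum>w\<in>?V. if w = u then (\<Sum>j<d. id_mat u v * complex_of_real (dir_weight j / total_weight)) else 0)"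
    by (intro sum.cong) (auto simp: tail_incidence_cube id_mat_def dir_coeff_square[symmetric])
  also have "\<dots> = (\<Sum>j<d. id_mat u v * complex_of_real (dir_weight j / total_weight))"
    using uv finite_cube_verts by simp
  also have "\<dots> = id_mat u v * complex_of_real ((\<Sum>j<d. dir_weight j) / total_weight)"
    by (simp only: sum_distrib_left[symmetric] of_real_sum[symmetric] sum_divide_distrib[symmetric])
  finally show "(\<Sum>q\<in>?A. ?N u q * cnj (?N v q)) = id_mat u v"
    using total_weight_pos by (simp add: total_weight_def)
qed auto

lemma up_cube:
  assumes "v \<in> cube_verts d" "j < d"
  shows "cw.up f (v, cube_flip v j) = complex_of_real (dir_coeff j) * f v"
proof -
  have "cw.up f (v, cube_flip v j) = (\<Sum>u\<in>cube_verts d. if u = v then complex_of_real (dir_coeff j) * f u else 0)"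
    unfolding cw.up_def by (intro sum.cong) (auto simp: tail_incidence_cube assms)
  then show ?thesis using assms finite_cube_verts by simp
qed

lemma down_cube:
  assumes "v \<in> cube_verts d"
  shows "cw.down x v = (\<Sum>j<d. complex_of_real (dir_coeff j) * x (v, cube_flip v j))"
proof -
  have "cw.down x v = (\<Sum>u\<in>cube_verts d. if u = v then (\<Sum>j<d. complex_of_real (dir_coeff j) * x (u, cube_flip u j)) else 0)"
    unfolding cw.down_def sum_arcs_cube by (intro sum.cong) (auto simp: tail_incidence_cube)
  then show ?thesis using assms finite_cube_verts by simp
qed

lemma down_reversed_up_cube:
  assumes "v \<in> cube_verts d"
  shows "cw.down (\<lambda>p. cw.up f (prod.swap p)) v =
    (\<Sum>j<d. complex_of_real (dir_weight j / total_weight) * f (cube_flip v j))"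
  unfolding down_cube[OF assms]
proof (intro sum.cong refl)
  fix j assume "j \<in> {..<d}"
  then show "complex_of_real (dir_coeff j) * cw.up f (prod.swap (v, cube_flip v j)) =
      complex_of_real (dir_weight j / total_weight) * f (cube_flip v j)"
    using up_cube[of "cube_flip v j" j f] assms by (simp flip: dir_coeff_square)
qed

lemma walk_matrix_cube:
  assumes "p \<in> arcs (cube_edges d)"
  shows "mat_vec (arcs (cube_edges d)) (walk_matrix (cube_verts d) (cube_edges d) (cube_weight d m)) x p = cw.step x p"
proof -
  let ?V = "cube_verts d" and ?A = "arcs (cube_edges d)" and ?W = "cube_weight d m"
  let ?N = "tail_incidence ?V ?W"
  define C where "C p q = 2 * mat_mult ?V (conj_transpose ?N) ?N p q - id_mat p q" for p q
  have U: "walk_matrix ?V (cube_edges d) ?W p q = C (prod.swap p) q" for q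
  proof -
    have "walk_matrix ?V (cube_edges d) ?W p q = (\<Sum>r\<in>?A. if r = prod.swap p then C r q else 0)"
      unfolding walk_matrix_def mat_mult_def[of ?A] C_def
      by (rule sum.cong) (auto simp: arc_reversal_def split: prod.splits)
    then show ?thesis using assms cw.finite_A cw.rev_in by simp
  qed
  have r: "prod.swap p \<in> ?A" using assms by (rule cw.rev_in)
  have "mat_vec ?A (walk_matrix ?V (cube_edges d) ?W) x p =
      2 * (\<Sum>q\<in>?A. (\<Sum>u\<in>?V. cnj (?N u (prod.swap p)) * ?N u q) * x q) - (\<Sum>q\<in>?A. id_mat (prod.swap p) q * x q)"
    unfolding mat_vec_def U C_def mat_mult_def conj_transpose_def
    by (simp only: left_diff_distrib sum_subtractf mult.assoc sum_distrib_left[of 2 _ ?A])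
  also have "(\<Sum>q\<in>?A. id_mat (prod.swap p) q * x q) = (\<Sum>q\<in>?A. if prod.swap p = q then x q else 0)"
    by (intro sum.cong) (auto simp: id_mat_def)
  also have "\<dots> = x (prod.swap p)"
    using r cw.finite_A by simp
  also have "(\<Sum>q\<in>?A. (\<Sum>u\<in>?V. cnj (?N u (prod.swap p)) * ?N u q) * x q) = cw.up (cw.down x) (prod.swap p)"
    unfolding cw.up_def cw.down_def sum_distrib_left sum_distrib_right by (subst sum.swap) (simp add: mult.assoc)
  finally show ?thesis by (simp add: cw.step_def)
qed

lemma vertex_state_cube: "vertex_state (cube_verts d) (cube_weight d m) a = cw.up (std_basis a)"
  by (simp add: vertex_state_def mat_vec_def cw.up_def conj_transpose_def fun_eq_iff)

section \<open>Characters of the cube and their eigenvalues\<close>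

definition cube_char :: "nat set \<Rightarrow> (nat \<Rightarrow> bit) \<Rightarrow> complex" where
  "cube_char S u = (\<Prod>j\<in>S. if u j = 0 then 1 else - 1) / 2 ^ d"

lemma cube_char_flip:
  assumes "finite S"
  shows "cube_char S (cube_flip u j) = (if j \<in> S then - 1 else 1) * cube_char S u"
proof (cases "j \<in> S")
  case True
  have "(\<Prod>i\<in>S-{j}. if cube_flip u j i = 0 then 1 else - 1) = (\<Prod>i\<in>S-{j}. if u i = 0 then 1 else - 1 :: complex)"
    by (intro prod.cong) (auto simp: cube_flip_def)
  moreover have "(if cube_flip u j j = 0 then 1 else - 1) = - (if u j = 0 then 1 else - 1 :: complex)"
    by (cases "u j") (auto simp: cube_flip_def)
  ultimately show ?thesis
    using True unfolding cube_char_def prod.remove[OF assms True] by simp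
next
  case False
  have "(\<Prod>i\<in>S. if cube_flip u j i = 0 then 1 else - 1) = (\<Prod>i\<in>S. if u i = 0 then 1 else - 1 :: complex)"
    using False by (intro prod.cong) (auto simp: cube_flip_def)
  then show ?thesis using False by (simp add: cube_char_def)
qed

text \<open>The sum over all \<open>S\<close> expands a product of factors
  \<open>1 \<plusminus> 1\<close>, one per coordinate. It is \<open>2 ^ d\<close> at the zero
  vertex, which explains the scaling of \<open>cube_char\<close>, and any nonzero coordinate
  annihilates it.\<close>

lemma sum_cube_char:
  assumes u: "u \<in> cube_verts d"
  shows "(\<Sum>S\<in>Pow {..<d}. cube_char S u) = std_basis cube_zero u"
proof -
  have "(\<Sum>S\<in>Pow {..<d}. cube_char S u) = (\<Prod>j<d. (if u j = 0 then 1 else - 1) + 1) / 2 ^ d"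
    unfolding cube_char_def by (subst prod_add) (auto simp: sum_divide_distrib)
  also have "\<dots> = std_basis cube_zero u"
  proof (cases "u = cube_zero")
    case True
    then show ?thesis by (simp add: std_basis_def cube_zero_def)
  next
    case False
    then obtain j where "u j \<noteq> 0" by (auto simp: cube_zero_def fun_eq_iff)
    moreover from this have "j < d" using u by (metis (mono_tags) cube_verts_def mem_Collect_eq not_less)
    ultimately have "(\<Prod>j<d. (if u j = 0 then 1 else - 1) + 1) = (0::complex)"
      by (intro prod_zero) auto
    then show ?thesis using False by (simp add: std_basis_def)
  qed
  finally show ?thesis .
qed

text \<open>The matrix \<open>N R N*\<close> averages over neighbours with weights
  \<open>dir_weight j / total_weight\<close>, and flipping coordinate \<open>j\<close> negates the
  character exactly for \<open>j \<in> S\<close>; this is the resulting eigenvalue.\<close>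

definition cube_eigenvalue :: "nat set \<Rightarrow> real" where
  "cube_eigenvalue S = (\<Sum>j<d. dir_weight j * (if j \<in> S then - 1 else 1)) / total_weight"

lemma abs_cube_eigenvalue_le: "\<bar>cube_eigenvalue S\<bar> \<le> 1"
proof -
  have "\<bar>\<Sum>j<d. dir_weight j * (if j \<in> S then - 1 else 1)\<bar> \<le> (\<Sum>j<d. \<bar>dir_weight j * (if j \<in> S then - 1 else 1)\<bar>)"
    by (rule sum_abs)
  also have "\<dots> = total_weight"
    unfolding total_weight_def using dir_weight_pos by (intro sum.cong) (auto simp: abs_mult less_imp_le)
  finally show ?thesis
    using total_weight_pos by (simp add: cube_eigenvalue_def)
qed

lemma cube_char_eigenvector:
  assumes "S \<subseteq> {..<d}" "u \<in> cube_verts d"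
  shows "cw.down (\<lambda>p. cw.up (cube_char S) (prod.swap p)) u =
    complex_of_real (cos (arccos (cube_eigenvalue S))) * cube_char S u"
proof -
  have "finite S" using assms finite_subset by blast
  then have "cw.down (\<lambda>p. cw.up (cube_char S) (prod.swap p)) u =
      (\<Sum>j<d. complex_of_real (dir_weight j * (if j \<in> S then - 1 else 1) / total_weight) * cube_char S u)"
    unfolding down_reversed_up_cube[OF assms(2)]
    by (intro sum.cong) (auto simp: cube_char_flip)
  also have "\<dots> = complex_of_real (cube_eigenvalue S) * cube_char S u"
    unfolding cube_eigenvalue_def sum_distrib_right[symmetric] of_real_sum[symmetric] sum_divide_distrib ..
  finally show ?thesis
    using abs_cube_eigenvalue_le[of S] by (simp add: cos_arccos_abs)
qed

lemma cube_ones_in: "cube_ones d \<in> cube_verts d"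
  by (simp add: cube_ones_def cube_verts_def)

lemma cube_zero_in: "cube_zero \<in> cube_verts d"
  by (simp add: cube_zero_def cube_verts_def)

lemma cube_char_ones:
  assumes "S \<subseteq> {..<d}"
  shows "cube_char S (cube_ones d) = (- 1) ^ card S / 2 ^ d"
proof -
  have "(\<Prod>j\<in>S. if cube_ones d j = 0 then 1 else - 1) = (\<Prod>j\<in>S. - 1 :: complex)"
    using assms by (intro prod.cong) (auto simp: cube_ones_def)
  then show ?thesis by (simp add: cube_char_def)
qed

text \<open>With phase 1 the squared distance is twice the average, over the \<open>2 ^ d\<close>
  sets \<open>S\<close>, of 1 minus the cosine times \<open>(- 1) ^ card S\<close>. A tolerance of
  \<open>\<epsilon>\<^sup>2 / 4\<close> for each \<open>S\<close> therefore leaves at most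
  \<open>\<epsilon>\<^sup>2 / 2\<close>.\<close>

lemma cube_PGST_if_cos_approx:
  assumes approx: "\<And>\<epsilon>. \<epsilon> > 0 \<Longrightarrow> \<exists>t::nat. \<forall>S\<subseteq>{..<d}.
    \<bar>cos (real t * arccos (cube_eigenvalue S)) - (- 1) ^ card S\<bar> < \<epsilon>"
  shows "vertex_PGST (cube_verts d) (cube_edges d) (cube_weight d m) cube_zero (cube_ones d)"
  unfolding vertex_PGST_def PGST_def vertex_state_cube
proof (intro exI[of _ "1::complex"] conjI allI impI)
  let ?A = "arcs (cube_edges d)" and ?U = "walk_matrix (cube_verts d) (cube_edges d) (cube_weight d m)"
  let ?x = "cw.up (std_basis cube_zero)" and ?y = "cw.up (std_basis (cube_ones d))"
  fix \<epsilon> :: real assume e: "\<epsilon> > 0"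
  then obtain t :: nat where t: "\<And>S. S \<subseteq> {..<d} \<Longrightarrow>
      \<bar>cos (real t * arccos (cube_eigenvalue S)) - (- 1) ^ card S\<bar> < \<epsilon>\<^sup>2 / 4"
    using approx[of "\<epsilon>\<^sup>2 / 4"] by auto
  define c where "c S = cos (real t * arccos (cube_eigenvalue S))" for S
  have "(\<Sum>p\<in>?A. (cmod ((cw.step ^^ t) ?x p - ?y p))\<^sup>2) =
      2 - 2 * Re (\<Sum>S\<in>Pow {..<d}. complex_of_real (c S) * cube_char S (cube_ones d))"
    unfolding c_def
    by (rule cw.transfer_error[OF cube_ones_in cube_zero_in]) (use cube_char_eigenvector sum_cube_char in auto)
  also have "(\<Sum>S\<in>Pow {..<d}. complex_of_real (c S) * cube_char S (cube_ones d)) =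
      complex_of_real (\<Sum>S\<in>Pow {..<d}. c S * (- 1) ^ card S / 2 ^ d)"
    unfolding of_real_sum by (intro sum.cong) (auto simp: cube_char_ones)
  also have "2 - 2 * Re (complex_of_real (\<Sum>S\<in>Pow {..<d}. c S * (- 1) ^ card S / 2 ^ d)) =
      (\<Sum>S\<in>Pow {..<d}. 2 / 2 ^ d * (1 - c S * (- 1) ^ card S))"
    by (simp add: right_diff_distrib sum_subtractf card_Pow sum_distrib_left)
  also have "\<dots> \<le> (\<Sum>S\<in>Pow {..<d}. 2 / 2 ^ d * (\<epsilon>\<^sup>2 / 4))"
  proof (intro sum_mono mult_left_mono)
    fix S assume "S \<in> Pow {..<d}"
    then have "\<bar>c S - (- 1) ^ card S\<bar> < \<epsilon>\<^sup>2 / 4" using t by (auto simp: c_def)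
    then show "1 - c S * (- 1) ^ card S \<le> \<epsilon>\<^sup>2 / 4"
      unfolding abs_less_iff by (cases "even (card S)") simp_all
  qed auto
  also have "\<dots> = \<epsilon>\<^sup>2 / 2" by (simp add: card_Pow)
  also have "\<dots> < \<epsilon>\<^sup>2" using e by simp
  finally have "sqrt (\<Sum>p\<in>?A. (cmod ((cw.step ^^ t) ?x p - ?y p))\<^sup>2) < \<epsilon>"
    using e by (simp add: real_less_lsqrt)
  moreover have "(\<Sum>p\<in>?A. (cmod (mat_vec ?A (mat_powi ?A ?U (int t)) ?x p - 1 * ?y p))\<^sup>2) =
      (\<Sum>p\<in>?A. (cmod ((cw.step ^^ t) ?x p - ?y p))\<^sup>2)"
  proof (intro sum.cong refl)
    fix p assume "p \<in> ?A"
    then have "mat_vec ?A (mat_power ?A ?U t) ?x p = (cw.step ^^ t) ?x p"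
      by (intro mat_vec_mat_power walk_matrix_cube cw.step_cong cw.finite_A) auto
    then show "(cmod (mat_vec ?A (mat_powi ?A ?U (int t)) ?x p - 1 * ?y p))\<^sup>2 =
        (cmod ((cw.step ^^ t) ?x p - ?y p))\<^sup>2"
      by (simp add: mat_powi_def)
  qed
  ultimately show "\<exists>t. vec_norm ?A (\<lambda>p. mat_vec ?A (mat_powi ?A ?U t) ?x p - 1 * ?y p) < \<epsilon>"
    unfolding vec_norm_def L2_set_def by (intro exI[of _ "int t"]) simp
qed auto

lemma cube_eigenvalue_eq:
  assumes "S \<subseteq> {..<d}"
  shows "cube_eigenvalue S = 1 - 2 * (\<Sum>j\<in>S. dir_weight j) / total_weight"
proof -
  have "(\<Sum>j<d. dir_weight j * (if j \<in> S then - 1 else 1)) =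
      (\<Sum>j<d. dir_weight j - 2 * (if j \<in> S then dir_weight j else 0))"
    by (intro sum.cong) auto
  also have "\<dots> = total_weight - 2 * (\<Sum>j<d. if j \<in> S then dir_weight j else 0)"
    by (simp only: sum_subtractf sum_distrib_left total_weight_def)
  also have "(\<Sum>j<d. if j \<in> S then dir_weight j else 0) = (\<Sum>j\<in>S. dir_weight j)"
    using assms by (simp add: sum.If_cases inf.absorb2)
  finally show ?thesis
    using total_weight_pos by (simp add: cube_eigenvalue_def diff_divide_distrib)
qed

lemma sum_dir_weight:
  assumes "finite S"
  shows "(\<Sum>j\<in>S. dir_weight j) = (if 0 \<in> S then real m - 2 else 0) + 2 * real (card S)"
proof -
  have "(\<Sum>j\<in>S. dir_weight j) = (\<Sum>j\<in>S. (if j = 0 then real m - 2 else 0) + 2)"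
    by (intro sum.cong) (auto simp: dir_weight_def)
  then show ?thesis using assms by (simp add: sum.distrib)
qed

end

section \<open>Prescribed sign patterns and the three cases\<close>

lemma arccos_reflect:
  assumes "k \<le> p" "p > 0"
  shows "arccos (1 - 2 * real (p - k) / real p) = pi - arccos (1 - 2 * real k / real p)"
proof -
  have "1 - 2 * real (p - k) / real p = - (1 - 2 * real k / real p)"
    using assms by (simp add: of_nat_diff field_simps)
  then show ?thesis
    using assms by (simp only:) (subst arccos_minus, auto simp: field_simps)
qed

text \<open>Reflecting \<open>k\<close> to \<open>p - k\<close> multiplies the cosine at time
  \<open>t\<close> by \<open>(- 1) ^ t\<close>, so the parity of \<open>r\<close> decides how the
  signs at \<open>k\<close> and \<open>p - k\<close> compare. The index 0 has angle 0 and cosine 1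
  at all times, whence \<open>e 0 = 0\<close>.\<close>

lemma sign_pattern_approx:
  fixes p r :: nat and e :: "nat \<Rightarrow> nat" and \<epsilon> :: real
  assumes p: "prime p" "odd p" and S: "S \<subseteq> {0<..<p}" "\<And>j k. j \<in> S \<Longrightarrow> k \<in> S \<Longrightarrow> j + k \<noteq> p"
    and e0: "e 0 = 0" and "\<epsilon> > 0"
  shows "\<exists>t::nat. \<forall>k\<in>insert 0 S.
    \<bar>cos (real t * arccos (1 - 2 * real k / real p)) - (- 1) ^ e k\<bar> < \<epsilon> \<and>
    \<bar>cos (real t * arccos (1 - 2 * real (p - k) / real p)) - (- 1) ^ (r + e k)\<bar> < \<epsilon>"
proof -
  obtain t :: nat where t: "even t = even r"
      "\<And>k. k \<in> S \<Longrightarrow> \<bar>cos (real t * arccos (1 - 2 * real k / real p)) - cos (real (e k) * pi)\<bar> < \<epsilon>"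
    using simultaneous_cos_approx[OF p S \<open>\<epsilon> > 0\<close>, of r "\<lambda>k. real (e k) * pi"] by blast
  have p0: "p > 0" using p(1) prime_gt_0_nat by blast
  show ?thesis
  proof (intro exI[of _ t] ballI)
    fix k assume k: "k \<in> insert 0 S"
    define \<theta> where "\<theta> = arccos (1 - 2 * real k / real p)"
    have 1: "\<bar>cos (real t * \<theta>) - (- 1) ^ e k\<bar> < \<epsilon>"
    proof (cases "k = 0")
      case True
      then show ?thesis using e0 \<open>\<epsilon> > 0\<close> by (simp add: \<theta>_def)
    next
      case False
      then show ?thesis using t(2)[of k] k by (simp add: \<theta>_def)
    qed
    have "k \<le> p" using k S(1) by auto
    then have "cos (real t * arccos (1 - 2 * real (p - k) / real p)) = cos (real t * pi - real t * \<theta>)"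
      using arccos_reflect[of k p] p0 by (simp only: \<theta>_def right_diff_distrib)
    also have "\<dots> = (- 1) ^ t * cos (real t * \<theta>)" by (simp add: cos_diff)
    also have "(- 1) ^ t = ((- 1) ^ r :: real)" using t(1) by (simp add: minus_one_power_iff)
    finally have "cos (real t * arccos (1 - 2 * real (p - k) / real p)) - (- 1) ^ (r + e k) =
        (- 1) ^ r * (cos (real t * \<theta>) - (- 1) ^ e k)"
      by (simp add: power_add algebra_simps)
    then have "\<bar>cos (real t * arccos (1 - 2 * real (p - k) / real p)) - (- 1) ^ (r + e k)\<bar> < \<epsilon>"
      using 1 by (simp add: abs_mult)
    with 1 show "\<bar>cos (real t * arccos (1 - 2 * real k / real p)) - (- 1) ^ e k\<bar> < \<epsilon> \<and>
        \<bar>cos (real t * arccos (1 - 2 * real (p - k) / real p)) - (- 1) ^ (r + e k)\<bar> < \<epsilon>"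
      by (simp add: \<theta>_def)
  qed
qed

text \<open>The eigenvalues are 1, 0 and -1 according to \<open>card S\<close>, so the transfer is
  exact at time 2.\<close>

lemma square_PGST: "vertex_PGST (cube_verts 2) (cube_edges 2) (cube_weight 2 2) cube_zero (cube_ones 2)"
proof -
  interpret weighted_cube 2 2 by unfold_locales auto
  show ?thesis
  proof (rule cube_PGST_if_cos_approx)
    fix \<epsilon> :: real assume "\<epsilon> > 0"
    have "cos (real 2 * arccos (cube_eigenvalue S)) = (- 1) ^ card S" if S: "S \<subseteq> {..<2}" for S
    proof -
      have fin: "finite S" using S finite_subset by blast
      have "cube_eigenvalue S = 1 - real (card S)"
        using S by (simp add: cube_eigenvalue_eq total_weight_eq sum_dir_weight[OF fin])
      moreover have "card S = 0 \<or> card S = 1 \<or> card S = 2"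
        using card_mono[OF _ S] by auto
      ultimately show ?thesis by auto
    qed
    then show "\<exists>t::nat. \<forall>S\<subseteq>{..<2}. \<bar>cos (real t * arccos (cube_eigenvalue S)) - (- 1) ^ card S\<bar> < \<epsilon>"
      using \<open>\<epsilon> > 0\<close> by (intro exI[of _ 2]) simp
  qed
qed

text \<open>All weights equal 2 and their total is \<open>2 * d\<close>, so the eigenvalue is
  \<open>1 - 2 * card S / d\<close>. As \<open>d\<close> is odd, the signs wanted at
  \<open>k\<close> and \<open>d - k\<close> are opposite, which is \<open>r = 1\<close>.\<close>

lemma odd_prime_cube_PGST:
  assumes pd: "prime d" "odd d"
  shows "vertex_PGST (cube_verts d) (cube_edges d) (cube_weight d 2) cube_zero (cube_ones d)"
proof -
  have d1: "1 \<le> d" using prime_ge_1_nat[OF pd(1)] .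
  interpret weighted_cube d 2 by unfold_locales (use d1 in auto)
  show ?thesis
  proof (rule cube_PGST_if_cos_approx)
    fix \<epsilon> :: real assume "\<epsilon> > 0"
    \<comment> \<open>The smaller member of each pair \<open>k\<close>, \<open>d - k\<close>
      represents it.\<close>
    define K where "K = {k. 0 < k \<and> 2 * k < d}"
    have K: "K \<subseteq> {0<..<d}" "\<And>j k. j \<in> K \<Longrightarrow> k \<in> K \<Longrightarrow> j + k \<noteq> d"
      by (auto simp: K_def)
    obtain t :: nat where t: "\<And>k. k \<in> insert 0 K \<Longrightarrow>
      \<bar>cos (real t * arccos (1 - 2 * real k / real d)) - (- 1) ^ k\<bar> < \<epsilon> \<and>
      \<bar>cos (real t * arccos (1 - 2 * real (d - k) / real d)) - (- 1) ^ (1 + k)\<bar> < \<epsilon>"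
      using sign_pattern_approx[OF pd K, of "\<lambda>k. k" \<epsilon> 1] \<open>\<epsilon> > 0\<close> by blast
    show "\<exists>t::nat. \<forall>S\<subseteq>{..<d}. \<bar>cos (real t * arccos (cube_eigenvalue S)) - (- 1) ^ card S\<bar> < \<epsilon>"
    proof (intro exI[of _ t] allI impI)
      fix S assume S: "S \<subseteq> {..<d}"
      have fin: "finite S" using S finite_subset by blast
      have ev: "cube_eigenvalue S = 1 - 2 * real (card S) / real d"
        using S d1 by (simp add: cube_eigenvalue_eq total_weight_eq sum_dir_weight[OF fin])
      have cS: "card S \<le> d" using card_mono[OF _ S] by simp
      show "\<bar>cos (real t * arccos (cube_eigenvalue S)) - (- 1) ^ card S\<bar> < \<epsilon>"
      proof (cases "2 * card S < d")
        case True
        then have "card S \<in> insert 0 K" by (auto simp: K_def)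
        then show ?thesis using t ev by simp
      next
        case False
        define k where "k = d - card S"
        have ck: "card S = d - k" "k \<le> d" using cS by (auto simp: k_def)
        have "2 * card S \<noteq> d" using pd(2) by auto
        then have "k \<in> insert 0 K" using False cS by (auto simp: K_def k_def)
        moreover have "even (card S) = even (1 + k)" using ck pd(2) by auto
        then have "(- 1) ^ card S = ((- 1) ^ (1 + k) :: real)" by (simp only: minus_one_power_iff)
        ultimately show ?thesis using t[of k] ev ck(1) by simp
      qed
    qed
  qed
qed

text \<open>A set without 0 has the even weight \<open>2 * card S\<close>; a set with 0 has weight
  \<open>p - 2 * j\<close> for \<open>j = d - card S\<close>. The signs wanted at
  \<open>2 * j\<close> and \<open>p - 2 * j\<close> are \<open>(- 1) ^ j\<close> and
  \<open>(- 1) ^ (d + j)\<close>, so the pattern is \<open>k div 2\<close> with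
  \<open>r = d\<close>.\<close>

lemma prime_total_weight_cube_PGST:
  assumes d: "d \<ge> 1" and m: "m \<ge> 1" and p: "prime (2 * d - 2 + m)" "odd (2 * d - 2 + m)"
  shows "vertex_PGST (cube_verts d) (cube_edges d) (cube_weight d m) cube_zero (cube_ones d)"
proof -
  interpret weighted_cube d m by unfold_locales (use d m in auto)
  show ?thesis
  proof (rule cube_PGST_if_cos_approx)
    define p where "p = 2 * d - 2 + m"
    fix \<epsilon> :: real assume "\<epsilon> > 0"
    \<comment> \<open>Representatives are the even weights: their pairwise sums are even and so
      differ from the odd prime \<open>p\<close>.\<close>
    define K where "K = (\<lambda>j. 2 * j) ` {0<..<d}"
    have "\<exists>t::nat. \<forall>k\<in>insert 0 K.
      \<bar>cos (real t * arccos (1 - 2 * real k / real p)) - (- 1) ^ (k div 2)\<bar> < \<epsilon> \<and>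
      \<bar>cos (real t * arccos (1 - 2 * real (p - k) / real p)) - (- 1) ^ (d + k div 2)\<bar> < \<epsilon>"
    proof (rule sign_pattern_approx)
      show "K \<subseteq> {0<..<p}" using m by (auto simp: K_def p_def)
      show "j + k \<noteq> p" if "j \<in> K" "k \<in> K" for j k
      proof -
        have "even (j + k)" using that by (auto simp: K_def)
        then show ?thesis using p(2) unfolding p_def by metis
      qed
    qed (use p \<open>\<epsilon> > 0\<close> in \<open>auto simp: p_def\<close>)
    then obtain t :: nat where t: "\<And>k. k \<in> insert 0 K \<Longrightarrow>
      \<bar>cos (real t * arccos (1 - 2 * real k / real p)) - (- 1) ^ (k div 2)\<bar> < \<epsilon> \<and>
      \<bar>cos (real t * arccos (1 - 2 * real (p - k) / real p)) - (- 1) ^ (d + k div 2)\<bar> < \<epsilon>"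
      by blast
    show "\<exists>t::nat. \<forall>S\<subseteq>{..<d}. \<bar>cos (real t * arccos (cube_eigenvalue S)) - (- 1) ^ card S\<bar> < \<epsilon>"
    proof (intro exI[of _ t] allI impI)
      fix S assume S: "S \<subseteq> {..<d}"
      have fin: "finite S" using S finite_subset by blast
      have cS: "card S \<le> d" using card_mono[OF _ S] by simp
      have ev: "cube_eigenvalue S = 1 - 2 * ((if 0 \<in> S then real m - 2 else 0) + 2 * real (card S)) / real p"
        using S d m by (simp add: cube_eigenvalue_eq total_weight_eq sum_dir_weight[OF fin] p_def)
      show "\<bar>cos (real t * arccos (cube_eigenvalue S)) - (- 1) ^ card S\<bar> < \<epsilon>"
      proof (cases "0 \<in> S")
        case False
        then have "S \<subset> {..<d}" using S d by auto
        then have "card S < d" using psubset_card_mono[of "{..<d}" S] by simp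
        then have "2 * card S \<in> insert 0 K" by (auto simp: K_def)
        from t[OF this] show ?thesis using ev False by simp
      next
        case True
        then have c0: "card S > 0" using fin card_gt_0_iff by blast
        define j where "j = d - card S"
        have "2 * j \<in> insert 0 K" using c0 cS by (auto simp: K_def j_def)
        note tj = t[OF this]
        have "real (p - 2 * j) = real m - 2 + 2 * real (card S)"
          using cS c0 m d by (simp add: p_def j_def of_nat_diff)
        then have "cube_eigenvalue S = 1 - 2 * real (p - 2 * j) / real p"
          using ev True by simp
        moreover have "even (card S) = even (d + j)" using cS by (simp add: j_def)
        then have "(- 1) ^ card S = ((- 1) ^ (d + j) :: real)" by (simp only: minus_one_power_iff)
        ultimately show ?thesis using tj by simp
      qed
    qed
  qed
qed

theorem theorem4p7:
  fixes d m :: nat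
  assumes "d \<ge> 2"
    and "prime d \<Longrightarrow> m = 2"
    and "\<not> prime d \<Longrightarrow> m = (LEAST k. 0 < k \<and> prime (2 * d - 2 + k))"
  shows "vertex_PGST (cube_verts d) (cube_edges d) (cube_weight d m) cube_zero (cube_ones d)"
proof (cases "prime d")
  case True
  then show ?thesis
    using assms(2) square_PGST odd_prime_cube_PGST prime_odd_nat[of d] assms(1)
    by (cases "d = 2") auto
next
  case False
  \<comment> \<open>The infinitude of primes makes the set under \<open>LEAST\<close> nonempty, so
    \<open>m\<close> has the defining property.\<close>
  obtain q where q: "prime q" "2 * d - 2 < q" using bigger_prime by blast
  have "0 < m \<and> prime (2 * d - 2 + m)"
    unfolding assms(3)[OF False]
    by (rule LeastI[of "\<lambda>k. 0 < k \<and> prime (2 * d - 2 + k)" "q - (2 * d - 2)"]) (use q in auto)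
  moreover have "odd (2 * d - 2 + m)"
    using calculation assms(1) by (intro prime_odd_nat) auto
  ultimately show ?thesis
    using assms(1) by (intro prime_total_weight_cube_PGST) auto
qed

end
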